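(* Let $\mathbf{Q}\in\mathbb{R}^{N\times N}$ be symmetric positive definite, $\mathbf{c}\in\mathbb{R}^N$, $\gamma>0$, with $c_n^2/(\mathbf{Q}^{-1})_{nn}\le\gamma$ for all $n=1,\ldots,N$. Let $K^*$ and $K_d$ be the maximum numbers of zero-valued components in the cardinality minimization problem with data $(\mathbf{Q},\mathbf{c},\gamma)$ and in its diagonal relaxation, respectively (see context). Define $$\underline{K}=\max\{K:\lambda_{\max}(\mathbf{Q}/\mathbf{Q}_{Y(K)Y(K)})\,S_K(\{c_n^2\})\le\gamma\},\qquad \overline{K}=\max\{K:\lambda_{\min}(\mathbf{Q})\,S_K(\{c_n^2\})\le\gamma\}.$$ Then $$\underline{K}\le K^*\le K_d\le\overline{K}.$$ Furthermore, the approximation ratio $K_d/K^*$ is bounded as follows: $$\frac{K_d}{K^*}\le\frac{\overline{K}}{\underline{K}}\le\frac{\left\lceil(\underline{K}+1)\,\lambda_{\max}\bigl(\mathbf{Q}/\mathbf{Q}_{Y(\underline{K}+1)Y(\underline{K}+1)}\bigr)/\lambda_{\min}(\mathbf{Q})\right\rceil-1}{\underline{K}}.$$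
   Context: The cardinality minimization problem with data $(\mathbf{Q},\mathbf{c},\gamma)$ is: minimize $C(\mathbf{x})$, the number of nonzero components of $\mathbf{x}\in\mathbb{R}^N$, subject to $(\mathbf{x}-\mathbf{c})^T\mathbf{Q}(\mathbf{x}-\mathbf{c})\le\gamma$. $K^*$ is $N$ minus its optimal cost, i.e. the maximum number of zero components of a feasible $\mathbf{x}$. The assumption on $c_n^2/(\mathbf{Q}^{-1})_{nn}$ says that for each $n$ there is a feasible $\mathbf{x}$ with $x_n=0$. $S_K(\{a_n\})$ denotes the sum of the $K$ smallest elements of the sequence $a_1,\ldots,a_N$; $K$ always denotes a number of components, at most $N$. Diagonal relaxation: for a diagonal matrix $\mathbf{D}$ with $\mathbf{0}\preceq\mathbf{D}\preceq\mathbf{Q}$ (Loewner order), replacing $\mathbf{Q}$ by $\mathbf{D}$ in the constraint gives a relaxation of the problem, which admits a feasible point with $K$ zero components iff $S_K(\{D_{nn}c_n^2\})\le\gamma$. The diagonal relaxation is the tightest relaxation of this kind. With $$E_d(K)=\max\{S_K(\{D_{nn}c_n^2\}):\mathbf{D}\text{ diagonal},\ \mathbf{0}\preceq\mathbf{D}\preceq\mathbf{Q}\},$$ $K_d$ is the largest $K$ such that $E_d(K)\le\gamma$. $Y(K)$ is the index set corresponding to the $N-K$ largest-magnitude components of $\mathbf{c}$; its complement $Z(K)$ corresponds to the $K$ smallest-magnitude components. For an index set $Y$ with complement $Z$, $\mathbf{Q}_{YZ}$ is the submatrix with rows in $Y$ and columns in $Z$, and $\mathbf{Q}/\mathbf{Q}_{YY}=\mathbf{Q}_{ZZ}-\mathbf{Q}_{ZY}(\mathbf{Q}_{YY})^{-1}\mathbf{Q}_{YZ}=\bigl((\mathbf{Q}^{-1})_{ZZ}\bigr)^{-1}$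 is the Schur complement. $\lambda_{\min},\lambda_{\max}$ denote smallest and largest eigenvalues. *)

theory Defs
  imports
    Complex_Main
    "Jordan_Normal_Form.DL_Submatrix"
    "Jordan_Normal_Form.Gauss_Jordan_Elimination"
    "Jordan_Normal_Form.Spectral_Radius"
begin

text \<open>Components are indexed by \<open>0, \<dots>, N - 1\<close>. Definiteness includes symmetry.\<close>

definition pos_def_mat :: "real mat \<Rightarrow> bool" where
  "pos_def_mat A \<longleftrightarrow> square_mat A \<and> transpose_mat A = A \<and>
     (\<forall>v \<in> carrier_vec (dim_row A). v \<noteq> 0\<^sub>v (dim_row A) \<longrightarrow> 0 < v \<bullet> (A *\<^sub>v v))"

definition pos_semidef_mat :: "real mat \<Rightarrow> bool" where
  "pos_semidef_mat A \<longleftrightarrow> square_mat A \<and> transpose_mat A = A \<and>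
     (\<forall>v \<in> carrier_vec (dim_row A). 0 \<le> v \<bullet> (A *\<^sub>v v))"

definition loewner_le :: "real mat \<Rightarrow> real mat \<Rightarrow> bool" where
  "loewner_le A B \<longleftrightarrow> dim_row A = dim_row B \<and> dim_col A = dim_col B \<and> pos_semidef_mat (B - A)"

text \<open>The \<^const>\<open>spectrum\<close> is the finite set of real eigenvalues. It is nonempty for
  symmetric matrices of positive size; for the matrix of size zero the two values below
  are unspecified.\<close>

definition lambda_max :: "real mat \<Rightarrow> real" where
  "lambda_max A = Max (spectrum A)"

definition lambda_min :: "real mat \<Rightarrow> real" where
  "lambda_min A = Min (spectrum A)"

text \<open>Only applied to invertible matrices.\<close>

definition mat_inv :: "real mat \<Rightarrow> real mat" where
  "mat_inv A = the (mat_inverse A)"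

definition schur_complement :: "real mat \<Rightarrow> nat set \<Rightarrow> real mat" where
  "schur_complement Q Y = (let Z = {0..<dim_row Q} - Y in
     submatrix Q Z Z - submatrix Q Z Y * mat_inv (submatrix Q Y Y) * submatrix Q Y Z)"

definition smallest_sum :: "nat \<Rightarrow> real list \<Rightarrow> real" where
  "smallest_sum K as = sum_list (take K (sort as))"

definition sq_entries :: "real vec \<Rightarrow> real list" where
  "sq_entries c = map (\<lambda>n. (c $ n)\<^sup>2) [0..<dim_vec c]"

text \<open>\<open>Y\<close> is the index set of some choice of the \<open>m\<close> largest-magnitude components of \<open>c\<close>.
  In case of ties there are several such sets.\<close>

definition largest_magnitude_indices :: "real vec \<Rightarrow> nat \<Rightarrow> nat set \<Rightarrow> bool" where
  "largest_magnitude_indices c m Y \<longleftrightarrow> Y \<subseteq> {0..<dim_vec c} \<and> card Y = m \<and>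
     (\<forall>i \<in> Y. \<forall>j \<in> {0..<dim_vec c} - Y. \<bar>c $ j\<bar> \<le> \<bar>c $ i\<bar>)"

definition feasible_set :: "real mat \<Rightarrow> real vec \<Rightarrow> real \<Rightarrow> real vec set" where
  "feasible_set Q c \<gamma> = {x \<in> carrier_vec (dim_vec c). (x - c) \<bullet> (Q *\<^sub>v (x - c)) \<le> \<gamma>}"

definition num_nonzero :: "real vec \<Rightarrow> nat" where
  "num_nonzero x = card {n. n < dim_vec x \<and> x $ n \<noteq> 0}"

definition K_star :: "real mat \<Rightarrow> real vec \<Rightarrow> real \<Rightarrow> nat" where
  "K_star Q c \<gamma> = dim_vec c - Min (num_nonzero ` feasible_set Q c \<gamma>)"

definition relaxing_diagonals :: "real mat \<Rightarrow> real mat set" where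
  "relaxing_diagonals Q = {D \<in> carrier_mat (dim_row Q) (dim_col Q). diagonal_mat D \<and>
     loewner_le (0\<^sub>m (dim_row Q) (dim_col Q)) D \<and> loewner_le D Q}"

text \<open>A maximum over an infinite set of reals, hence \<open>GREATEST\<close> rather than \<open>Max\<close>;
  it is attained by compactness of the set of admissible diagonal matrices.\<close>

definition E_d :: "real mat \<Rightarrow> real vec \<Rightarrow> nat \<Rightarrow> real" where
  "E_d Q c K = (GREATEST e. \<exists>D \<in> relaxing_diagonals Q.
     e = smallest_sum K (map (\<lambda>n. D $$ (n, n) * (c $ n)\<^sup>2) [0..<dim_vec c]))"

definition K_d :: "real mat \<Rightarrow> real vec \<Rightarrow> real \<Rightarrow> nat" where
  "K_d Q c \<gamma> = Max {K. K \<le> dim_vec c \<and> E_d Q c K \<le> \<gamma>}"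

text \<open>The argument \<open>Y\<close> provides the index sets \<open>Y K\<close>. For \<open>K = 0\<close> the Schur complement
  has size zero, but its coefficient, a sum of zero terms, vanishes.\<close>

definition K_lower :: "real mat \<Rightarrow> real vec \<Rightarrow> real \<Rightarrow> (nat \<Rightarrow> nat set) \<Rightarrow> nat" where
  "K_lower Q c \<gamma> Y = Max {K. K \<le> dim_vec c \<and>
     lambda_max (schur_complement Q (Y K)) * smallest_sum K (sq_entries c) \<le> \<gamma>}"

definition K_upper :: "real mat \<Rightarrow> real vec \<Rightarrow> real \<Rightarrow> nat" where
  "K_upper Q c \<gamma> = Max {K. K \<le> dim_vec c \<and>
     lambda_min Q * smallest_sum K (sq_entries c) \<le> \<gamma>}"

end

theory Submission
  imports Defs
begin

text \<open>
Prescribing zeros on an index set \<open>Z\<close> with complement \<open>Y\<close> means prescribing \<open>x - c\<close> on \<open>Z\<close> to be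
\<open>- c\<^sub>Z\<close>. Minimizing the form of \<open>Q\<close> over the free components leaves the form of the Schur complement
\<open>Q / Q\<^sub>Y\<^sub>Y\<close> at \<open>c\<^sub>Z\<close> (\<open>schur_complement_extension\<close>, \<open>schur_complement_form\<close>). Its largest eigenvalue
times the squared norm of \<open>c\<^sub>Z\<close> bounds this cost, and taking for \<open>Z\<close> the \<open>K\<close> smallest components of \<open>c\<close> shows that the lower
bound is achieved by a feasible point (\<open>feasible_vanishing_point\<close>).

In the other direction, the cost of a feasible point in a diagonal form below \<open>Q\<close> is at least the
contribution of its zero components, so the original optimum is feasible for the diagonal
relaxation (\<open>E_d_K_star_le\<close>). The relaxation in turn is at least as tight as the one with the
diagonal matrix \<open>\<lambda>\<^sub>m\<^sub>i\<^sub>n I\<close>, which gives the upper bound (\<open>lambda_min_smallest_sum_le_E_d\<close>). Both steps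
need that the maximum defining \<^const>\<open>E_d\<close> exists (\<open>E_d_attained\<close>).

The first ratio bound follows from these inequalities once the lower bound is positive; it is,
because for a single index the Schur complement is the reciprocal of a diagonal entry of the
inverse of \<open>Q\<close> (\<open>lambda_max_schur_singleton\<close>). For the second one, the lower bound plus one violates
its defining inequality; as averages of the smallest squares do not decrease with their number
(\<open>smallest_sum_superlinear\<close>), the violation at this index limits how far the upper bound can go
(\<open>K_upper_less\<close>).

Everything rests on the two bounds of a symmetric form by its extremal eigenvalues
(\<open>lambda_max_symmetric\<close>, \<open>lambda_min_symmetric\<close>).
\<close>

section \<open>Extremal eigenvalues of symmetric matrices\<close>

lemma scalar_prod_self_pos:
  fixes v :: "real vec"
  assumes "v \<in> carrier_vec n" and "v \<noteq> 0\<^sub>v n"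
  shows "0 < v \<bullet> v"
proof -
  obtain i where i: "i < n" "v $ i \<noteq> 0"
    using assms by (metis carrier_vecD eq_vecI index_zero_vec(1) index_zero_vec(2))
  show ?thesis unfolding scalar_prod_def
    by (rule sum_pos2[of _ i]) (use assms i in \<open>auto simp: zero_less_mult_iff linorder_neq_iff\<close>)
qed

lemma scalar_prod_self_nonneg: "0 \<le> (v :: real vec) \<bullet> v"
  unfolding scalar_prod_def by (intro sum_nonneg) auto

lemma quadratic_form_bounded:
  fixes A :: "real mat"
  assumes A: "A \<in> carrier_mat n n"
  shows "\<exists>C>0. \<forall>v\<in>carrier_vec n. \<bar>v \<bullet> (A *\<^sub>v v)\<bar> \<le> C * (v \<bullet> v)"
proof -
  \<comment> \<open>The summand 1 makes the bound positive even for the zero matrix.\<close>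
  define C where "C = 1 + (\<Sum>i=0..<n. \<Sum>j=0..<n. \<bar>A $$ (i, j)\<bar>)"
  have "C > 0" unfolding C_def by (intro add_pos_nonneg sum_nonneg) auto
  moreover have "\<bar>v \<bullet> (A *\<^sub>v v)\<bar> \<le> C * (v \<bullet> v)" if v: "v \<in> carrier_vec n" for v
  proof -
    have sq: "v $ i * v $ i \<le> v \<bullet> v" if "i < n" for i
      unfolding scalar_prod_def using v that
      by (intro member_le_sum[where f="\<lambda>i. v $ i * v $ i"]) auto
    have prod: "\<bar>v $ i * v $ j\<bar> \<le> v \<bullet> v" if "i < n" "j < n" for i j
    proof -
      have "0 \<le> (\<bar>v $ i\<bar> - \<bar>v $ j\<bar>)\<^sup>2" by simp
      hence "2 * \<bar>v $ i * v $ j\<bar> \<le> v $ i * v $ i + v $ j * v $ j"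
        by (simp add: power2_diff abs_mult) (simp add: power2_eq_square)
      thus ?thesis using sq[OF that(1)] sq[OF that(2)] by linarith
    qed
    have "v \<bullet> (A *\<^sub>v v) = (\<Sum>i=0..<n. \<Sum>j=0..<n. A $$ (i, j) * (v $ i * v $ j))"
      using A v unfolding scalar_prod_def
      by (auto simp: scalar_prod_def sum_distrib_left mult_ac intro!: sum.cong)
    also have "\<bar>\<dots>\<bar> \<le> (\<Sum>i=0..<n. \<Sum>j=0..<n. \<bar>A $$ (i, j)\<bar> * (v \<bullet> v))"
      by (intro order_trans[OF sum_abs] sum_mono)
         (use prod in \<open>auto simp: abs_mult[of "A $$ _"] intro!: mult_left_mono\<close>)
    also have "\<dots> \<le> C * (v \<bullet> v)"
      unfolding C_def using scalar_prod_self_nonneg[of v]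
      by (simp add: sum_distrib_right[symmetric] distrib_right)
    finally show ?thesis .
  qed
  ultimately show ?thesis by blast
qed

lemma symmetric_bilinear_swap:
  fixes A :: "real mat"
  assumes "A \<in> carrier_mat n n" "transpose_mat A = A" "u \<in> carrier_vec n" "v \<in> carrier_vec n"
  shows "u \<bullet> (A *\<^sub>v v) = v \<bullet> (A *\<^sub>v u)"
  using transpose_vec_mult_scalar[OF assms(1), of v u] assms
  by (metis comm_scalar_prod mult_mat_vec_carrier)

text \<open>The least constant \<open>\<mu>\<close> that dominates the form of \<open>A\<close> is an eigenvalue. Otherwise
\<open>G = A - \<mu> I\<close> has an inverse \<open>B\<close>. Since \<open>G\<close> is negative semidefinite, its form at
\<open>v + t B v\<close>, which equals \<open>v \<bullet> G v + 2 t (v \<bullet> v) + t\<^sup>2 (B v \<bullet> v)\<close>, is at most \<open>0\<close>. If the form of \<open>B\<close>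
is bounded by \<open>c\<close>, then \<open>t = 1 / c\<close> gives \<open>v \<bullet> G v \<le> - (v \<bullet> v) / c\<close>, so \<open>\<mu> - 1 / c\<close> dominates
the form of \<open>A\<close> as well.\<close>

lemma exists_max_eigenvalue:
  fixes A :: "real mat"
  assumes A: "A \<in> carrier_mat n n" and sym: "transpose_mat A = A" and n: "0 < n"
  shows "\<exists>\<mu>. eigenvalue A \<mu> \<and> (\<forall>v\<in>carrier_vec n. v \<bullet> (A *\<^sub>v v) \<le> \<mu> * (v \<bullet> v))"
proof -
  define M where "M = {m. \<forall>v\<in>carrier_vec n. v \<bullet> (A *\<^sub>v v) \<le> m * (v \<bullet> v)}"
  define \<mu> where "\<mu> = Inf M"
  obtain C where C: "\<forall>v\<in>carrier_vec n. \<bar>v \<bullet> (A *\<^sub>v v)\<bar> \<le> C * (v \<bullet> v)"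
    using quadratic_form_bounded[OF A] by blast
  have "C \<in> M" using C unfolding M_def by (auto simp: abs_le_iff)
  have lower: "bdd_below M"
  proof (rule bdd_belowI)
    fix m assume "m \<in> M"
    hence "unit_vec n 0 \<bullet> (A *\<^sub>v unit_vec n 0) \<le> m * (unit_vec n 0 \<bullet> unit_vec n 0)"
      unfolding M_def using unit_vec_carrier by blast
    thus "unit_vec n 0 \<bullet> (A *\<^sub>v unit_vec n 0) \<le> m"
      using scalar_prod_right_unit[OF n, of "unit_vec n 0 :: real vec"] n by simp
  qed
  have \<mu>M: "\<mu> \<in> M" unfolding M_def
  proof (intro CollectI ballI)
    fix v :: "real vec" assume v: "v \<in> carrier_vec n"
    show "v \<bullet> (A *\<^sub>v v) \<le> \<mu> * (v \<bullet> v)"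
    proof (cases "v = 0\<^sub>v n")
      case True
      thus ?thesis using A by (simp add: scalar_prod_left_zero[of _ n])
    next
      case False
      hence pos: "0 < v \<bullet> v" using v by (rule scalar_prod_self_pos[rotated])
      have "(v \<bullet> (A *\<^sub>v v)) / (v \<bullet> v) \<le> \<mu>"
        unfolding \<mu>_def using \<open>C \<in> M\<close> v pos
        by (intro cInf_greatest) (auto simp: M_def field_simps)
      thus ?thesis using pos by (simp add: field_simps)
    qed
  qed
  define G where "G = char_matrix A \<mu>"
  have G: "G \<in> carrier_mat n n" unfolding G_def using A by simp
  have scale: "((- \<mu>) \<cdot>\<^sub>m 1\<^sub>m n) *\<^sub>v v = (- \<mu>) \<cdot>\<^sub>v v" if "v \<in> carrier_vec n" for v
    using that by (intro eq_vecI) (auto simp: smult_scalar_prod_distrib[of _ n])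
  have Gv: "G *\<^sub>v v = A *\<^sub>v v + (- \<mu>) \<cdot>\<^sub>v v" if "v \<in> carrier_vec n" for v
    unfolding G_def char_matrix_def using A that
    by (simp add: add_mult_distrib_mat_vec[of _ n n] scale)
  have Gform: "u \<bullet> (G *\<^sub>v v) = u \<bullet> (A *\<^sub>v v) - \<mu> * (u \<bullet> v)"
    if "u \<in> carrier_vec n" "v \<in> carrier_vec n" for u v
    using that A by (simp add: Gv scalar_prod_add_distrib[of _ n])
  have "det G = 0"
  proof (rule ccontr)
    assume det: "det G \<noteq> 0"
    then obtain B where B: "B \<in> carrier_mat n n" "G * B = 1\<^sub>m n"
      using det_non_zero_imp_unit[OF G det, of "()"] by (auto simp: Units_def ring_mat_def)
    obtain c where c: "c > 0" "\<forall>v\<in>carrier_vec n. \<bar>v \<bullet> (B *\<^sub>v v)\<bar> \<le> c * (v \<bullet> v)"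
      using quadratic_form_bounded[OF B(1)] by blast
    \<comment> \<open>This contradicts the minimality of \<open>\<mu>\<close>.\<close>
    have "\<mu> - 1 / c \<in> M" unfolding M_def
    proof (intro CollectI ballI)
      fix v :: "real vec" assume v: "v \<in> carrier_vec n"
      define u where "u = B *\<^sub>v v"
      define w where "w = v + (1 / c) \<cdot>\<^sub>v u"
      have u: "u \<in> carrier_vec n" unfolding u_def using B v by simp
      have w: "w \<in> carrier_vec n" unfolding w_def using u v by simp
      have Gu: "G *\<^sub>v u = v"
        unfolding u_def using G B v by (simp add: assoc_mult_mat_vec[symmetric])
      have uGv: "u \<bullet> (G *\<^sub>v v) = v \<bullet> (G *\<^sub>v u)"
        using symmetric_bilinear_swap[OF A sym u v] comm_scalar_prod[OF u v]
        by (simp add: Gform u v)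
      have uv: "u \<bullet> v = v \<bullet> (B *\<^sub>v v)"
        using comm_scalar_prod[OF u v] by (simp add: u_def)
      have Gw: "G *\<^sub>v w = G *\<^sub>v v + (1 / c) \<cdot>\<^sub>v v"
        unfolding w_def using G u v by (simp add: mult_add_distrib_mat_vec[of _ n n] mult_mat_vec Gu)
      have "w \<bullet> (G *\<^sub>v w) = v \<bullet> (G *\<^sub>v v) + 2 / c * (v \<bullet> v) + 1 / c ^ 2 * (u \<bullet> v)"
        unfolding Gw using G u v
        by (simp add: w_def add_scalar_prod_distrib[of _ n] scalar_prod_add_distrib[of _ n] uGv Gu
            power2_eq_square add_divide_distrib)
      moreover have "w \<bullet> (G *\<^sub>v w) \<le> 0"
        using \<mu>M w unfolding M_def by (simp add: Gform w)
      moreover have "- (1 / c * (v \<bullet> v)) \<le> 1 / c ^ 2 * (u \<bullet> v)"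
      proof -
        have "- (c * (v \<bullet> v)) \<le> u \<bullet> v" using c(2) v uv by (auto simp: abs_le_iff)
        hence "1 / c ^ 2 * - (c * (v \<bullet> v)) \<le> 1 / c ^ 2 * (u \<bullet> v)"
          by (intro mult_left_mono) auto
        thus ?thesis using c(1) by (simp add: power2_eq_square)
      qed
      ultimately show "v \<bullet> (A *\<^sub>v v) \<le> (\<mu> - 1 / c) * (v \<bullet> v)"
        by (simp add: Gform v algebra_simps)
    qed
    hence "\<mu> \<le> \<mu> - 1 / c" unfolding \<mu>_def by (rule cInf_lower[OF _ lower])
    thus False using c(1) by simp
  qed
  hence "eigenvalue A \<mu>" unfolding G_def eigenvalue_det[OF A] .
  thus ?thesis using \<mu>M unfolding M_def by blast
qed

lemma lambda_max_symmetric: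
  assumes A: "A \<in> carrier_mat n n" and sym: "transpose_mat A = A" and n: "0 < n"
  shows eigenvalue_lambda_max: "eigenvalue A (lambda_max A)"
    and form_le_lambda_max: "\<And>v. v \<in> carrier_vec n \<Longrightarrow> v \<bullet> (A *\<^sub>v v) \<le> lambda_max A * (v \<bullet> v)"
proof -
  obtain \<mu> where \<mu>: "eigenvalue A \<mu>" "\<forall>v\<in>carrier_vec n. v \<bullet> (A *\<^sub>v v) \<le> \<mu> * (v \<bullet> v)"
    using exists_max_eigenvalue[OF assms] by blast
  have fin: "finite (spectrum A)" and mem: "\<mu> \<in> spectrum A"
    using card_finite_spectrum[OF A] \<mu>(1) by (auto simp: spectrum_def)
  have "lambda_max A \<in> spectrum A" unfolding lambda_max_def using fin mem by (intro Max_in) auto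
  thus "eigenvalue A (lambda_max A)" by (simp add: spectrum_def)
  fix v :: "real vec" assume "v \<in> carrier_vec n"
  hence "v \<bullet> (A *\<^sub>v v) \<le> \<mu> * (v \<bullet> v)" using \<mu>(2) by blast
  also have "\<dots> \<le> lambda_max A * (v \<bullet> v)"
    unfolding lambda_max_def using fin mem scalar_prod_self_nonneg by (intro mult_right_mono) auto
  finally show "v \<bullet> (A *\<^sub>v v) \<le> lambda_max A * (v \<bullet> v)" .
qed

text \<open>The largest eigenvalue of \<open>- A\<close>, with opposite sign, bounds the form of \<open>A\<close> from below.\<close>

lemma lambda_min_symmetric:
  assumes A: "A \<in> carrier_mat n n" and sym: "transpose_mat A = A" and n: "0 < n"
  shows eigenvalue_lambda_min: "eigenvalue A (lambda_min A)"
    and lambda_min_le_form: "\<And>v. v \<in> carrier_vec n \<Longrightarrow> lambda_min A * (v \<bullet> v) \<le> v \<bullet> (A *\<^sub>v v)"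
proof -
  have "- A \<in> carrier_mat n n" "transpose_mat (- A) = - A" 
    using A sym by (auto simp: transpose_uminus)
  then obtain \<mu> where \<mu>: "eigenvalue (- A) \<mu>"
      "\<forall>v\<in>carrier_vec n. v \<bullet> (- A *\<^sub>v v) \<le> \<mu> * (v \<bullet> v)"
    using exists_max_eigenvalue[of "- A" n] n by blast
  obtain x where x: "x \<in> carrier_vec n" "x \<noteq> 0\<^sub>v n" "- A *\<^sub>v x = \<mu> \<cdot>\<^sub>v x"
    using \<mu>(1) A by (auto simp: eigenvalue_def eigenvector_def)
  have neg: "- A *\<^sub>v v = - (A *\<^sub>v v)" if "v \<in> carrier_vec n" for v
    using A that by (intro uminus_mult_mat_vec) auto
  have "A *\<^sub>v x = - (\<mu> \<cdot>\<^sub>v x)" unfolding x(3)[symmetric] neg[OF x(1)] by simp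
  also have "\<dots> = (- \<mu>) \<cdot>\<^sub>v x" by (intro eq_vecI) auto
  finally have "A *\<^sub>v x = (- \<mu>) \<cdot>\<^sub>v x" .
  hence "eigenvalue A (- \<mu>)" using A x by (auto simp: eigenvalue_def eigenvector_def)
  hence fin: "finite (spectrum A)" and mem: "- \<mu> \<in> spectrum A"
    using card_finite_spectrum[OF A] by (auto simp: spectrum_def)
  have "lambda_min A \<in> spectrum A" unfolding lambda_min_def using fin mem by (intro Min_in) auto
  thus "eigenvalue A (lambda_min A)" by (simp add: spectrum_def)
  fix v :: "real vec" assume v: "v \<in> carrier_vec n"
  have "lambda_min A * (v \<bullet> v) \<le> - \<mu> * (v \<bullet> v)"
    unfolding lambda_min_def using fin mem scalar_prod_self_nonneg by (intro mult_right_mono) auto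
  also have "\<dots> \<le> v \<bullet> (A *\<^sub>v v)"
  proof -
    have "v \<bullet> (- A *\<^sub>v v) = - (v \<bullet> (A *\<^sub>v v))"
      unfolding neg[OF v] using A v by (intro scalar_prod_uminus_right) auto
    thus ?thesis using \<mu>(2) v by fastforce
  qed
  finally show "lambda_min A * (v \<bullet> v) \<le> v \<bullet> (A *\<^sub>v v)" .
qed

section \<open>Schur complements\<close>

text \<open>\<^const>\<open>submatrix\<close> enumerates an index set increasingly by \<^const>\<open>pick\<close>. Restricting vectors with
the same enumeration makes block computations compatible with \<^const>\<open>submatrix\<close>.\<close>

definition subvec :: "real vec \<Rightarrow> nat set \<Rightarrow> real vec" where
  "subvec x I = vec (card I) (\<lambda>i. x $ pick I i)"

lemma subvec_carrier [simp]: "subvec x I \<in> carrier_vec (card I)"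
  by (simp add: subvec_def)

lemma bij_betw_pick:
  assumes "finite I"
  shows "bij_betw (pick I) {0..<card I} I"
proof (rule bij_betw_imageI)
  show inj: "inj_on (pick I) {0..<card I}"
    by (rule inj_on_inverseI[of _ "\<lambda>n. card {a\<in>I. a < n}"]) (auto simp: card_pick)
  show "pick I ` {0..<card I} = I"
    by (rule card_subset_eq[OF assms]) (auto simp: card_image[OF inj] pick_in_set)
qed

lemma sum_pick:
  assumes "finite I"
  shows "(\<Sum>i=0..<card I. g (pick I i)) = sum g I"
  using sum.reindex_bij_betw[OF bij_betw_pick[OF assms], of g] .

lemma scalar_prod_subvec:
  assumes "x \<in> carrier_vec N" "y \<in> carrier_vec N" "Y \<subseteq> {0..<N}"
  shows "x \<bullet> y = subvec x ({0..<N} - Y) \<bullet> subvec y ({0..<N} - Y) + subvec x Y \<bullet> subvec y Y"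
proof -
  have fin: "finite Y" using assms(3) finite_subset by blast
  have "x \<bullet> y = (\<Sum>i\<in>{0..<N}. x $ i * y $ i)" using assms by (simp add: scalar_prod_def)
  also have "\<dots> = (\<Sum>i\<in>{0..<N} - Y. x $ i * y $ i) + (\<Sum>i\<in>Y. x $ i * y $ i)"
    using assms(3) by (simp add: sum.subset_diff)
  also have "\<dots> = subvec x ({0..<N} - Y) \<bullet> subvec y ({0..<N} - Y) + subvec x Y \<bullet> subvec y Y"
    using sum_pick[of "{0..<N} - Y" "\<lambda>i. x $ i * y $ i"] sum_pick[OF fin, of "\<lambda>i. x $ i * y $ i"]
    by (simp add: scalar_prod_def subvec_def)
  finally show ?thesis .
qed

lemma submatrix_carrier:
  assumes "Q \<in> carrier_mat N N" "I \<subseteq> {0..<N}" "J \<subseteq> {0..<N}"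
  shows "submatrix Q I J \<in> carrier_mat (card I) (card J)"
proof -
  have "{i. i < N \<and> i \<in> I} = I" "{i. i < N \<and> i \<in> J} = J" using assms by auto
  thus ?thesis using assms(1) by (auto simp: submatrix_def)
qed

lemma subvec_mult:
  assumes Q: "Q \<in> carrier_mat N N" and x: "x \<in> carrier_vec N"
    and Y: "Y \<subseteq> {0..<N}" and I: "I \<subseteq> {0..<N}"
  shows "subvec (Q *\<^sub>v x) I =
    submatrix Q I ({0..<N} - Y) *\<^sub>v subvec x ({0..<N} - Y) + submatrix Q I Y *\<^sub>v subvec x Y"
    (is "_ = ?A *\<^sub>v ?z + ?B *\<^sub>v ?y")
proof (rule eq_vecI)
  have Z: "{0..<N} - Y \<subseteq> {0..<N}" by auto
  have A: "?A \<in> carrier_mat (card I) (card ({0..<N} - Y))" using Q I Z by (rule submatrix_carrier)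
  have B: "?B \<in> carrier_mat (card I) (card Y)" using Q I Y by (rule submatrix_carrier)
  show "dim_vec (subvec (Q *\<^sub>v x) I) = dim_vec (?A *\<^sub>v ?z + ?B *\<^sub>v ?y)"
    using A B by (simp add: subvec_def)
  fix i assume "i < dim_vec (?A *\<^sub>v ?z + ?B *\<^sub>v ?y)"
  hence i: "i < card I" using B by simp
  have pi: "pick I i < N" using I pick_in_set[of i I] i by auto
  have row: "row (submatrix Q I J) i = subvec (row Q (pick I i)) J" if J: "J \<subseteq> {0..<N}" for J
  proof (rule eq_vecI)
    have C: "submatrix Q I J \<in> carrier_mat (card I) (card J)" using Q I J by (rule submatrix_carrier)
    show "dim_vec (row (submatrix Q I J) i) = dim_vec (subvec (row Q (pick I i)) J)"
      using C by (simp add: subvec_def)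
    fix j assume "j < dim_vec (subvec (row Q (pick I i)) J)"
    hence j: "j < card J" by (simp add: subvec_def)
    have pj: "pick J j < N" using J pick_in_set[of j J] j by auto
    have "{i. i < N \<and> i \<in> I} = I" "{i. i < N \<and> i \<in> J} = J" using I J by auto
    thus "row (submatrix Q I J) i $ j = subvec (row Q (pick I i)) J $ j"
      using Q C i j pi pj by (simp add: subvec_def submatrix_index)
  qed
  have "subvec (Q *\<^sub>v x) I $ i = row Q (pick I i) \<bullet> x"
    using i pi Q by (simp add: subvec_def)
  also have "\<dots> = row ?A i \<bullet> ?z + row ?B i \<bullet> ?y"
    unfolding row[OF Z] row[OF Y] using Q pi by (intro scalar_prod_subvec[OF _ x Y]) auto
  finally show "subvec (Q *\<^sub>v x) I $ i = (?A *\<^sub>v ?z + ?B *\<^sub>v ?y) $ i"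
    using A B i by simp
qed

lemma subvec_surj:
  assumes Y: "Y \<subseteq> {0..<N}"
    and z: "z \<in> carrier_vec (card ({0..<N} - Y))" and y: "y \<in> carrier_vec (card Y)"
  shows "\<exists>x\<in>carrier_vec N. subvec x ({0..<N} - Y) = z \<and> subvec x Y = y"
proof
  define Z where "Z = {0..<N} - Y"
  define x where "x = vec N (\<lambda>n. if n \<in> Y then y $ card {a\<in>Y. a < n} else z $ card {a\<in>Z. a < n})"
  show "x \<in> carrier_vec N" by (simp add: x_def)
  have "x $ pick Y i = y $ i" if "i < card Y" for i
    using that Y pick_in_set[of i Y] card_pick[of i Y] by (auto simp: x_def)
  moreover have "x $ pick Z i = z $ i" if "i < card Z" for i
    using that pick_in_set[of i Z] card_pick[of i Z] by (auto simp: x_def Z_def)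
  ultimately show "subvec x ({0..<N} - Y) = z \<and> subvec x Y = y"
    unfolding Z_def[symmetric] using y z by (auto simp: subvec_def Z_def[symmetric] intro!: eq_vecI)
qed

lemma pos_def_matD:
  assumes "pos_def_mat A" "A \<in> carrier_mat n n"
  shows "transpose_mat A = A" "\<And>v. v \<in> carrier_vec n \<Longrightarrow> v \<noteq> 0\<^sub>v n \<Longrightarrow> 0 < v \<bullet> (A *\<^sub>v v)"
    "\<And>v. v \<in> carrier_vec n \<Longrightarrow> 0 \<le> v \<bullet> (A *\<^sub>v v)"
proof -
  show "transpose_mat A = A" using assms unfolding pos_def_mat_def by auto
  show pos: "0 < v \<bullet> (A *\<^sub>v v)" if "v \<in> carrier_vec n" "v \<noteq> 0\<^sub>v n" for v
    using that assms unfolding pos_def_mat_def by auto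
  show "0 \<le> v \<bullet> (A *\<^sub>v v)" if "v \<in> carrier_vec n" for v
    using pos[OF that] that assms(2) by (cases "v = 0\<^sub>v n") auto
qed

lemma mat_inv_if_injective:
  fixes A :: "real mat"
  assumes A: "A \<in> carrier_mat n n"
    and inj: "\<And>v. v \<in> carrier_vec n \<Longrightarrow> A *\<^sub>v v = 0\<^sub>v n \<Longrightarrow> v = 0\<^sub>v n"
  shows "mat_inv A \<in> carrier_mat n n" "A * mat_inv A = 1\<^sub>m n" "mat_inv A * A = 1\<^sub>m n"
proof -
  have "det A \<noteq> 0" using inj unfolding det_0_iff_vec_prod_zero_field[OF A] by blast
  hence "A \<in> Units (ring_mat TYPE(real) n ())" by (rule det_non_zero_imp_unit[OF A])
  then obtain B where B: "mat_inverse A = Some B"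
    using mat_inverse(1)[OF A, of "()"] by (cases "mat_inverse A") auto
  thus "mat_inv A \<in> carrier_mat n n" "A * mat_inv A = 1\<^sub>m n" "mat_inv A * A = 1\<^sub>m n"
    using mat_inverse(2)[OF A B] by (auto simp: mat_inv_def)
qed

lemma pos_def_mat_inv:
  assumes "pos_def_mat A" "A \<in> carrier_mat n n"
  shows "mat_inv A \<in> carrier_mat n n" "A * mat_inv A = 1\<^sub>m n" "mat_inv A * A = 1\<^sub>m n"
proof -
  have "v = 0\<^sub>v n" if "v \<in> carrier_vec n" "A *\<^sub>v v = 0\<^sub>v n" for v
    using pos_def_matD(2)[OF assms that(1)] that by auto
  from mat_inv_if_injective[OF assms(2) this]
  show "mat_inv A \<in> carrier_mat n n" "A * mat_inv A = 1\<^sub>m n" "mat_inv A * A = 1\<^sub>m n" by auto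
qed

text \<open>A kernel vector of the principal block, extended by zeros, would make the form of \<open>Q\<close> vanish.\<close>

lemma principal_submatrix_injective:
  assumes Q: "Q \<in> carrier_mat N N" and pd: "pos_def_mat Q" and Y: "Y \<subseteq> {0..<N}"
    and y: "y \<in> carrier_vec (card Y)" "submatrix Q Y Y *\<^sub>v y = 0\<^sub>v (card Y)"
  shows "y = 0\<^sub>v (card Y)"
proof (rule ccontr)
  assume ne: "y \<noteq> 0\<^sub>v (card Y)"
  obtain x where x: "x \<in> carrier_vec N" "subvec x ({0..<N} - Y) = 0\<^sub>v (card ({0..<N} - Y))"
      "subvec x Y = y"
    using subvec_surj[OF Y _ y(1)] zero_carrier_vec by blast
  have "submatrix Q Y ({0..<N} - Y) \<in> carrier_mat (card Y) (card ({0..<N} - Y))"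
    using Q Y by (intro submatrix_carrier) auto
  hence "submatrix Q Y ({0..<N} - Y) *\<^sub>v 0\<^sub>v (card ({0..<N} - Y)) = 0\<^sub>v (card Y)"
    by (intro eq_vecI) auto
  hence "subvec (Q *\<^sub>v x) Y = 0\<^sub>v (card Y)"
    unfolding subvec_mult[OF Q x(1) Y Y] x(2,3) y(2) by simp
  hence "x \<bullet> (Q *\<^sub>v x) = 0"
    using Q x y scalar_prod_subvec[OF x(1) _ Y, of "Q *\<^sub>v x"]
    by simp
  hence "x = 0\<^sub>v N" using pos_def_matD(2)[OF pd Q x(1)] by fastforce
  hence "y $ i = 0" if "i < card Y" for i
    using x(3)[symmetric] that Y pick_in_set[of i Y] by (auto simp: subvec_def)
  thus False using ne y(1) by auto
qed

lemma schur_complement_carrier: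
  assumes "Q \<in> carrier_mat N N" "Y \<subseteq> {0..<N}"
  shows "schur_complement Q Y \<in> carrier_mat (card ({0..<N} - Y)) (card ({0..<N} - Y))"
proof -
  have "submatrix Q Y ({0..<N} - Y) \<in> carrier_mat (card Y) (card ({0..<N} - Y))"
      "submatrix Q ({0..<N} - Y) Y \<in> carrier_mat (card ({0..<N} - Y)) (card Y)"
    using assms by (auto intro!: submatrix_carrier)
  thus ?thesis using assms(1) unfolding schur_complement_def Let_def by auto
qed

text \<open>Block elimination: with \<open>y = - Q\<^sub>Y\<^sub>Y\<^sup>-\<^sup>1 Q\<^sub>Y\<^sub>Z z\<close> on \<open>Y\<close>, the block equations say that \<open>Q x\<close> vanishes on \<open>Y\<close>
and equals the Schur complement times \<open>z\<close> on the complement \<open>Z\<close> of \<open>Y\<close>. This \<open>x\<close> minimizes the form of \<open>Q\<close> among all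
vectors that agree with \<open>z\<close> on \<open>Z\<close>. The symmetry of the Schur complement and
its eigenvalue bounds are read off from such extensions.\<close>

lemma schur_complement_extension:
  assumes Q: "Q \<in> carrier_mat N N" and pd: "pos_def_mat Q" and Y: "Y \<subseteq> {0..<N}"
    and z: "z \<in> carrier_vec (card ({0..<N} - Y))"
  obtains x where "x \<in> carrier_vec N" "subvec x ({0..<N} - Y) = z"
    "subvec (Q *\<^sub>v x) ({0..<N} - Y) = schur_complement Q Y *\<^sub>v z"
    "subvec (Q *\<^sub>v x) Y = 0\<^sub>v (card Y)"
proof -
  define Z where "Z = {0..<N} - Y"
  note z = z[folded Z_def]
  have Z: "Z \<subseteq> {0..<N}" unfolding Z_def by auto
  define A B C D where "A = submatrix Q Z Z" and "B = submatrix Q Z Y"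
    and "C = submatrix Q Y Z" and "D = submatrix Q Y Y"
  have car: "A \<in> carrier_mat (card Z) (card Z)" "B \<in> carrier_mat (card Z) (card Y)"
      "C \<in> carrier_mat (card Y) (card Z)" "D \<in> carrier_mat (card Y) (card Y)"
    unfolding A_def B_def C_def D_def using Q Y Z by (auto intro!: submatrix_carrier)
  have inv: "mat_inv D \<in> carrier_mat (card Y) (card Y)" "D * mat_inv D = 1\<^sub>m (card Y)"
    using mat_inv_if_injective[OF car(4)] principal_submatrix_injective[OF Q pd Y]
    unfolding D_def by auto
  define y where "y = - (mat_inv D *\<^sub>v (C *\<^sub>v z))"
  have Cz: "C *\<^sub>v z \<in> carrier_vec (card Y)" using car z by simp
  have w: "mat_inv D *\<^sub>v (C *\<^sub>v z) \<in> carrier_vec (card Y)" using inv Cz by simp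
  have y: "y \<in> carrier_vec (card Y)" unfolding y_def using w by simp
  have neg: "M *\<^sub>v y = - (M *\<^sub>v (mat_inv D *\<^sub>v (C *\<^sub>v z)))"
    if "M \<in> carrier_mat k (card Y)" for M k
    unfolding y_def using that w inv by (intro eq_vecI) (auto intro!: scalar_prod_uminus_right)
  obtain x where x: "x \<in> carrier_vec N" "subvec x Z = z" "subvec x Y = y"
    using subvec_surj[OF Y _ y] z unfolding Z_def by blast
  note mult = subvec_mult[OF Q x(1) Y, folded Z_def]
  have "D *\<^sub>v (mat_inv D *\<^sub>v (C *\<^sub>v z)) = C *\<^sub>v z"
    using inv car Cz by (simp add: assoc_mult_mat_vec[symmetric, of D])
  hence "subvec (Q *\<^sub>v x) Y = C *\<^sub>v z + - (C *\<^sub>v z)"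
    unfolding mult[OF Y] x C_def[symmetric] D_def[symmetric] neg[OF car(4)] by simp
  hence 1: "subvec (Q *\<^sub>v x) Y = 0\<^sub>v (card Y)" using Cz by simp
  have "schur_complement Q Y *\<^sub>v z = A *\<^sub>v z - B * mat_inv D * C *\<^sub>v z"
    unfolding schur_complement_def Let_def using Q car inv z
    by (simp add: Z_def[symmetric] A_def[symmetric] B_def[symmetric] C_def[symmetric]
        D_def[symmetric] minus_mult_distrib_mat_vec[of _ "card Z" "card Z"])
  also have "B * mat_inv D * C *\<^sub>v z = B *\<^sub>v (mat_inv D *\<^sub>v (C *\<^sub>v z))"
    using assoc_mult_mat_vec[OF mult_carrier_mat[OF car(2) inv(1)] car(3) z]
      assoc_mult_mat_vec[OF car(2) inv(1) Cz] by metis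
  also have "A *\<^sub>v z - B *\<^sub>v (mat_inv D *\<^sub>v (C *\<^sub>v z)) = A *\<^sub>v z + B *\<^sub>v y"
    unfolding neg[OF car(2)] using car w z by (intro eq_vecI) auto
  also have "\<dots> = subvec (Q *\<^sub>v x) Z"
    unfolding mult[OF Z] x A_def B_def ..
  finally have 2: "subvec (Q *\<^sub>v x) Z = schur_complement Q Y *\<^sub>v z" ..
  show thesis using that[OF x(1)] x(2) 1 2 unfolding Z_def by blast
qed

text \<open>Since \<open>Q x\<close> vanishes on \<open>Y\<close>, only the components of \<open>x'\<close> outside \<open>Y\<close> contribute. For
\<open>x' = x\<close> this says that the form of the Schur complement at \<open>z\<close> is the form of \<open>Q\<close> at the
extension of \<open>z\<close>.\<close>

lemma schur_complement_form:
  assumes "Q \<in> carrier_mat N N" "Y \<subseteq> {0..<N}" "x \<in> carrier_vec N" "x' \<in> carrier_vec N"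
    and "subvec (Q *\<^sub>v x) ({0..<N} - Y) = schur_complement Q Y *\<^sub>v z"
    and "subvec (Q *\<^sub>v x) Y = 0\<^sub>v (card Y)"
  shows "x' \<bullet> (Q *\<^sub>v x) = subvec x' ({0..<N} - Y) \<bullet> (schur_complement Q Y *\<^sub>v z)"
  using scalar_prod_subvec[OF assms(4) _ assms(2), of "Q *\<^sub>v x"] assms by simp

lemma transpose_eq_if_bilinear_swap:
  fixes A :: "real mat"
  assumes A: "A \<in> carrier_mat n n"
    and swap: "\<And>u v. u \<in> carrier_vec n \<Longrightarrow> v \<in> carrier_vec n \<Longrightarrow> u \<bullet> (A *\<^sub>v v) = v \<bullet> (A *\<^sub>v u)"
  shows "transpose_mat A = A"
proof (rule eq_matI)
  fix i j assume "i < dim_row A" "j < dim_col A"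
  hence ij: "i < n" "j < n" using A by auto
  have entry: "A $$ (k, l) = unit_vec n k \<bullet> (A *\<^sub>v unit_vec n l)" if "k < n" "l < n" for k l
    using A that by (simp add: row_def)
  show "transpose_mat A $$ (i, j) = A $$ (i, j)"
    using A ij entry[OF ij] entry[of j i] swap[of "unit_vec n i" "unit_vec n j"] by simp
qed (use A in auto)

text \<open>The bilinear form of the Schur complement is that of \<open>Q\<close> on extensions, hence symmetric.\<close>

lemma schur_complement_symmetric:
  assumes Q: "Q \<in> carrier_mat N N" and pd: "pos_def_mat Q" and Y: "Y \<subseteq> {0..<N}"
  shows "transpose_mat (schur_complement Q Y) = schur_complement Q Y"
proof (rule transpose_eq_if_bilinear_swap[OF schur_complement_carrier[OF Q Y]])
  fix u v :: "real vec"
  assume u: "u \<in> carrier_vec (card ({0..<N} - Y))" and v: "v \<in> carrier_vec (card ({0..<N} - Y))"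
  obtain x where x: "x \<in> carrier_vec N" "subvec x ({0..<N} - Y) = u"
    "subvec (Q *\<^sub>v x) ({0..<N} - Y) = schur_complement Q Y *\<^sub>v u"
    "subvec (Q *\<^sub>v x) Y = 0\<^sub>v (card Y)"
    using schur_complement_extension[OF Q pd Y u] .
  obtain y where y: "y \<in> carrier_vec N" "subvec y ({0..<N} - Y) = v"
    "subvec (Q *\<^sub>v y) ({0..<N} - Y) = schur_complement Q Y *\<^sub>v v"
    "subvec (Q *\<^sub>v y) Y = 0\<^sub>v (card Y)"
    using schur_complement_extension[OF Q pd Y v] .
  have "x \<bullet> (Q *\<^sub>v y) = y \<bullet> (Q *\<^sub>v x)"
    using symmetric_bilinear_swap[OF Q pos_def_matD(1)[OF pd Q] x(1) y(1)] .
  thus "u \<bullet> (schur_complement Q Y *\<^sub>v v) = v \<bullet> (schur_complement Q Y *\<^sub>v u)"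
    using schur_complement_form[OF Q Y y(1) x(1) y(3,4)] schur_complement_form[OF Q Y x(1) y(1) x(3,4)]
    by (simp add: x(2) y(2))
qed

section \<open>Sums of the smallest entries\<close>

text \<open>The common elements of \<open>T\<close> and \<open>Z\<close> contribute equally to both sums. The remaining parts
\<open>T - Z\<close> and \<open>Z - T\<close> have equal cardinality, and the largest value on \<open>T - Z\<close> separates them.\<close>

lemma sum_le_if_least_elements:
  fixes f :: "'a \<Rightarrow> real"
  assumes "finite A" "T \<subseteq> A" "Z \<subseteq> A" "card T = card Z"
    and least: "\<And>i j. i \<in> T \<Longrightarrow> j \<in> A - T \<Longrightarrow> f i \<le> f j"
  shows "sum f T \<le> sum f Z"
proof -
  have fin: "finite T" "finite Z" using assms finite_subset by auto
  have card: "card (T - Z) = card (Z - T)"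
    using fin assms(4) by (simp add: card_Diff_subset_Int Int_commute)
  have "sum f (T - Z) \<le> sum f (Z - T)"
  proof (cases "T - Z = {}")
    case True
    hence "Z - T = {}" using card fin by (metis card_0_eq card.empty finite_Diff)
    with True show ?thesis by simp
  next
    case False
    define m where "m = Max (f ` (T - Z))"
    have "m \<in> f ` (T - Z)" unfolding m_def using False fin by (intro Max_in) auto
    then obtain i where i: "i \<in> T" "m = f i" by auto
    have "sum f (T - Z) \<le> of_nat (card (T - Z)) * m"
      unfolding m_def using fin by (intro sum_bounded_above) auto
    also have "\<dots> \<le> sum f (Z - T)"
      unfolding card using i least assms(3) by (intro sum_bounded_below) auto
    finally show ?thesis .
  qed
  moreover have "sum f T = sum f (T \<inter> Z) + sum f (T - Z)" "sum f Z = sum f (Z \<inter> T) + sum f (Z - T)"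
    using fin by (auto simp: sum.Int_Diff)
  ultimately show ?thesis by (simp add: Int_commute)
qed

text \<open>Sorting the indices by their values, instead of the values, turns a sum over a prefix of the
sorted list into a sum over a set of indices. This set is what connects \<^const>\<open>smallest_sum\<close>
with sets of vanishing components.\<close>

lemma smallest_sum_attained:
  fixes f :: "nat \<Rightarrow> real"
  assumes "K \<le> N"
  obtains T where "T \<subseteq> {0..<N}" "card T = K" "smallest_sum K (map f [0..<N]) = sum f T"
    "\<And>i j. i \<in> T \<Longrightarrow> j \<in> {0..<N} - T \<Longrightarrow> f i \<le> f j"
proof
  define xs where "xs = sort_key f [0..<N]"
  define T where "T = set (take K xs)"
  have xs: "set xs = {0..<N}" "distinct xs" "length xs = N" "sorted (map f xs)"
    unfolding xs_def by auto
  have split: "set xs = T \<union> set (drop K xs)"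
    unfolding T_def by (metis append_take_drop_id set_append)
  show "T \<subseteq> {0..<N}" using split xs(1) by auto
  show "card T = K" unfolding T_def using xs assms by (simp add: distinct_card)
  have "sort (map f [0..<N]) = map f xs"
    by (rule properties_for_sort) (auto simp: xs_def)
  thus "smallest_sum K (map f [0..<N]) = sum f T"
    unfolding smallest_sum_def T_def using xs(2)
    by (simp add: take_map sum_list_distinct_conv_sum_set)
  fix i j assume "i \<in> T" "j \<in> {0..<N} - T"
  hence "j \<in> set (drop K xs)" using split xs(1) by auto
  moreover have "sorted (map f (take K xs) @ map f (drop K xs))"
    using xs(4) by (simp flip: map_append)
  ultimately show "f i \<le> f j"
    using \<open>i \<in> T\<close> unfolding sorted_append T_def by auto
qed

lemma smallest_sum_le:
  fixes f :: "nat \<Rightarrow> real"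
  assumes "Z \<subseteq> {0..<N}" "card Z = K"
  shows "smallest_sum K (map f [0..<N]) \<le> sum f Z"
proof -
  have "K \<le> N" using assms card_mono[of "{0..<N}" Z] by simp
  then obtain T where T: "T \<subseteq> {0..<N}" "card T = K" "smallest_sum K (map f [0..<N]) = sum f T"
    "\<And>i j. i \<in> T \<Longrightarrow> j \<in> {0..<N} - T \<Longrightarrow> f i \<le> f j"
    using smallest_sum_attained[of K N f] by blast
  thus ?thesis using sum_le_if_least_elements[of "{0..<N}" T Z f] assms by simp
qed

lemma smallest_sum_eq:
  fixes f :: "nat \<Rightarrow> real"
  assumes "Z \<subseteq> {0..<N}" "card Z = K"
    and least: "\<And>i j. i \<in> Z \<Longrightarrow> j \<in> {0..<N} - Z \<Longrightarrow> f i \<le> f j"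
  shows "smallest_sum K (map f [0..<N]) = sum f Z"
proof (rule antisym)
  show "smallest_sum K (map f [0..<N]) \<le> sum f Z"
    using assms by (intro smallest_sum_le)
  have "K \<le> N" using assms card_mono[of "{0..<N}" Z] by simp
  then obtain T where T: "T \<subseteq> {0..<N}" "card T = K" "smallest_sum K (map f [0..<N]) = sum f T"
    using smallest_sum_attained[of K N f] by blast
  thus "sum f Z \<le> smallest_sum K (map f [0..<N])"
    using sum_le_if_least_elements[of "{0..<N}" Z T f] assms by simp
qed

text \<open>Every entry after the first \<open>K\<close> of the sorted list is at least the \<open>K\<close>-th one, which is at
least the average of the first \<open>K\<close>. Hence the averages of initial segments do not decrease.\<close>

lemma smallest_sum_superlinear:
  assumes "1 \<le> K" "K \<le> M" "M \<le> length as"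
  shows "real M * smallest_sum K as \<le> real K * smallest_sum M as"
proof -
  define ys where "ys = sort as"
  have ys: "length ys = length as" "sorted ys" unfolding ys_def by auto
  have S: "smallest_sum m as = (\<Sum>i=0..<m. ys ! i)" if "m \<le> length as" for m
    unfolding smallest_sum_def ys_def[symmetric] using that ys(1) by (simp add: sum_list_sum_nth)
  let ?b = "ys ! (K - 1)"
  have "(\<Sum>i=0..<K. ys ! i) \<le> of_nat (card {0..<K}) * ?b"
    using assms ys by (intro sum_bounded_above) (auto intro!: sorted_nth_mono)
  hence low: "(\<Sum>i=0..<K. ys ! i) \<le> real K * ?b" by simp
  have "of_nat (card {K..<M}) * ?b \<le> (\<Sum>i=K..<M. ys ! i)"
    using assms ys by (intro sum_bounded_below) (auto intro!: sorted_nth_mono)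
  hence high: "(real M - real K) * ?b \<le> (\<Sum>i=K..<M. ys ! i)" using assms by (simp add: of_nat_diff)
  have "(real M - real K) * (\<Sum>i=0..<K. ys ! i) \<le> (real M - real K) * (real K * ?b)"
    using low assms by (intro mult_left_mono) auto
  also have "\<dots> = real K * ((real M - real K) * ?b)" by simp
  also have "\<dots> \<le> real K * (\<Sum>i=K..<M. ys ! i)"
    using high by (intro mult_left_mono) auto
  finally have "real M * (\<Sum>i=0..<K. ys ! i) \<le> real K * ((\<Sum>i=0..<K. ys ! i) + (\<Sum>i=K..<M. ys ! i))"
    by (simp add: algebra_simps)
  also have "(\<Sum>i=0..<K. ys ! i) + (\<Sum>i=K..<M. ys ! i) = (\<Sum>i=0..<M. ys ! i)"
    using assms by (intro sum.atLeastLessThan_concat) auto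
  finally show ?thesis using S assms by simp
qed

section \<open>The diagonal relaxation attains its optimum\<close>

text \<open>Compactness of a box in finitely many dimensions, in the sequential form needed for the
diagonals of matrices.\<close>

lemma bounded_sequences_common_convergent_subsequence:
  fixes d :: "nat \<Rightarrow> nat \<Rightarrow> real"
  assumes "\<And>k n. n < N \<Longrightarrow> \<bar>d k n\<bar> \<le> b n"
  shows "\<exists>r. strict_mono r \<and> (\<forall>n<N. convergent (\<lambda>k. d (r k) n))"
  using assms
proof (induction N)
  case 0
  show ?case by (rule exI[of _ id]) (auto simp: strict_mono_def)
next
  case (Suc N)
  then obtain r where r: "strict_mono r" "\<forall>n<N. convergent (\<lambda>k. d (r k) n)" by auto
  obtain s where s: "strict_mono s" "monoseq (\<lambda>k. d (r (s k)) N)"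
    using seq_monosub[of "\<lambda>k. d (r k) N"] by blast
  have "convergent (\<lambda>k. d (r (s k)) N)"
    using Suc.prems[of N] s(2)
    by (intro Bseq_monoseq_convergent) (auto intro: BseqI'[where K="b N"])
  moreover have "convergent (\<lambda>k. d (r (s k)) n)" if "n < N" for n
    using convergent_subseq_convergent[OF r(2)[rule_format, OF that] s(1)] by (simp add: o_def)
  moreover have "strict_mono (\<lambda>k. r (s k))" using r(1) s(1) by (simp add: strict_mono_def)
  ultimately show ?case
    by (intro exI[of _ "\<lambda>k. r (s k)"]) (auto simp: less_Suc_eq)
qed

lemma form_diff:
  fixes A B :: "real mat"
  assumes "A \<in> carrier_mat n n" "B \<in> carrier_mat n n" "v \<in> carrier_vec n"
  shows "v \<bullet> ((B - A) *\<^sub>v v) = v \<bullet> (B *\<^sub>v v) - v \<bullet> (A *\<^sub>v v)"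
  using assms by (simp add: minus_mult_distrib_mat_vec scalar_prod_minus_distrib[of _ n])

lemma form_diagonal:
  fixes D :: "real mat"
  assumes "D \<in> carrier_mat n n" "diagonal_mat D" "v \<in> carrier_vec n"
  shows "v \<bullet> (D *\<^sub>v v) = (\<Sum>i=0..<n. D $$ (i, i) * (v $ i)\<^sup>2)"
proof -
  have "(D *\<^sub>v v) $ i = D $$ (i, i) * v $ i" if "i < n" for i
  proof -
    have "(D *\<^sub>v v) $ i = (\<Sum>j=0..<n. D $$ (i, j) * v $ j)"
      using assms that by (simp add: scalar_prod_def)
    also have "\<dots> = (\<Sum>j=0..<n. if j = i then D $$ (i, i) * v $ i else 0)"
      using assms that by (intro sum.cong) (auto simp: diagonal_mat_def)
    finally show ?thesis using that by simp
  qed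
  thus ?thesis using assms
    by (auto simp: scalar_prod_def power2_eq_square mult_ac intro!: sum.cong)
qed

definition diag_of :: "nat \<Rightarrow> (nat \<Rightarrow> real) \<Rightarrow> real mat" where
  "diag_of n d = mat n n (\<lambda>(i, j). if i = j then d i else 0)"

lemma diag_of_simps [simp]:
  "diag_of n d \<in> carrier_mat n n" "diagonal_mat (diag_of n d)"
  "i < n \<Longrightarrow> diag_of n d $$ (i, i) = d i"
  by (auto simp: diag_of_def diagonal_mat_def)

lemma diagonal_transpose:
  assumes "D \<in> carrier_mat n n" "diagonal_mat D"
  shows "transpose_mat D = D"
  using assms by (intro eq_matI) (auto simp: diagonal_mat_def, metis)

text \<open>For diagonal matrices the two Loewner conditions become inequalities that are linear in the
diagonal entries; such inequalities are preserved under limits.\<close>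

lemma relaxing_diagonals_iff:
  assumes Q: "Q \<in> carrier_mat N N" and sym: "transpose_mat Q = Q"
  shows "D \<in> relaxing_diagonals Q \<longleftrightarrow> D \<in> carrier_mat N N \<and> diagonal_mat D \<and>
    (\<forall>n<N. 0 \<le> D $$ (n, n)) \<and>
    (\<forall>v\<in>carrier_vec N. (\<Sum>n=0..<N. D $$ (n, n) * (v $ n)\<^sup>2) \<le> v \<bullet> (Q *\<^sub>v v))"
proof (cases "D \<in> carrier_mat N N \<and> diagonal_mat D")
  case True
  hence D: "D \<in> carrier_mat N N" "diagonal_mat D" by auto
  have D0: "D - 0\<^sub>m N N = D" using D by auto
  have Dsym: "transpose_mat D = D" using D by (rule diagonal_transpose)
  have QDsym: "transpose_mat (Q - D) = Q - D"
    using D Q Dsym sym by (simp add: transpose_minus)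
  have 1: "pos_semidef_mat D \<longleftrightarrow> (\<forall>n<N. 0 \<le> D $$ (n, n))"
  proof
    assume psd: "pos_semidef_mat D"
    show "\<forall>n<N. 0 \<le> D $$ (n, n)"
    proof (intro allI impI)
      fix n assume n: "n < N"
      have "0 \<le> unit_vec N n \<bullet> (D *\<^sub>v unit_vec N n)"
        using psd D unfolding pos_semidef_mat_def by auto
      thus "0 \<le> D $$ (n, n)"
        using D n by (simp add: row_def)
    qed
  next
    assume "\<forall>n<N. 0 \<le> D $$ (n, n)"
    thus "pos_semidef_mat D" unfolding pos_semidef_mat_def
      using D Dsym by (auto simp: form_diagonal[OF D] intro!: sum_nonneg)
  qed
  have 2: "pos_semidef_mat (Q - D) \<longleftrightarrow>
    (\<forall>v\<in>carrier_vec N. (\<Sum>n=0..<N. D $$ (n, n) * (v $ n)\<^sup>2) \<le> v \<bullet> (Q *\<^sub>v v))"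
    unfolding pos_semidef_mat_def using D Q QDsym
    by (auto simp: form_diff[OF D(1) Q] form_diagonal[OF D])
  show ?thesis
    using D Q 1 2 unfolding relaxing_diagonals_def loewner_le_def by (auto simp: D0)
next
  case False
  thus ?thesis using Q unfolding relaxing_diagonals_def by auto
qed

text \<open>The entries of admissible diagonals are bounded by
those of \<open>Q\<close>, so a maximizing sequence has a convergent subsequence with an admissible limit.
The objective is the minimum of finitely many linear functions, hence upper
semicontinuous: the sum over the index set that is optimal for the limit bounds the
objective along the whole sequence.\<close>

lemma E_d_attained:
  assumes Q: "Q \<in> carrier_mat N N" and sym: "transpose_mat Q = Q"
    and psd: "\<And>v. v \<in> carrier_vec N \<Longrightarrow> 0 \<le> v \<bullet> (Q *\<^sub>v v)"
    and c: "dim_vec c = N" and K: "K \<le> N"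
  shows "\<exists>D\<in>relaxing_diagonals Q. E_d Q c K = smallest_sum K (map (\<lambda>n. D $$ (n, n) * (c $ n)\<^sup>2) [0..<N])"
    and "\<And>D. D \<in> relaxing_diagonals Q \<Longrightarrow>
      smallest_sum K (map (\<lambda>n. D $$ (n, n) * (c $ n)\<^sup>2) [0..<N]) \<le> E_d Q c K"
proof -
  define S where "S D = smallest_sum K (map (\<lambda>n. D $$ (n, n) * (c $ n)\<^sup>2) [0..<N])" for D :: "real mat"
  note iff = relaxing_diagonals_iff[OF Q sym]
  have bound: "\<bar>D $$ (n, n)\<bar> \<le> Q $$ (n, n)" if "D \<in> relaxing_diagonals Q" "n < N" for D n
  proof -
    have D: "D \<in> carrier_mat N N" "diagonal_mat D" "0 \<le> D $$ (n, n)" using that by (auto simp: iff)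
    have "unit_vec N n \<bullet> (D *\<^sub>v unit_vec N n) \<le> unit_vec N n \<bullet> (Q *\<^sub>v unit_vec N n)"
      using that(1) by (simp add: iff form_diagonal[OF D(1,2)])
    thus ?thesis using D Q that(2) by (simp add: row_def)
  qed
  have zero: "0\<^sub>m N N \<in> relaxing_diagonals Q"
    unfolding iff using psd by (auto simp: diagonal_mat_def)
  have S_le: "S D \<le> (\<Sum>n=0..<N. Q $$ (n, n) * (c $ n)\<^sup>2)" if "D \<in> relaxing_diagonals Q" for D
  proof -
    have "S D \<le> (\<Sum>n=0..<K. D $$ (n, n) * (c $ n)\<^sup>2)"
      unfolding S_def using K by (intro smallest_sum_le) auto
    also have "\<dots> \<le> (\<Sum>n=0..<K. Q $$ (n, n) * (c $ n)\<^sup>2)"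
      using bound[OF that] K by (intro sum_mono mult_right_mono) (auto simp: abs_le_iff)
    also have "\<dots> \<le> (\<Sum>n=0..<N. Q $$ (n, n) * (c $ n)\<^sup>2)"
      using K bound[OF zero] by (intro sum_mono2 mult_nonneg_nonneg) (auto intro: order_trans[OF abs_ge_zero])
    finally show ?thesis .
  qed
  define s where "s = (SUP D\<in>relaxing_diagonals Q. S D)"
  have bdd: "bdd_above (S ` relaxing_diagonals Q)" using S_le by (intro bdd_aboveI2) auto
  have S_le_s: "S D \<le> s" if "D \<in> relaxing_diagonals Q" for D
    unfolding s_def using bdd that by (rule cSUP_upper[rotated])
  have "\<exists>D\<in>relaxing_diagonals Q. s - 1 / Suc k < S D" for k
    using less_cSUP_iff[OF _ bdd, of "s - 1 / Suc k"] zero by (auto simp: s_def[symmetric])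
  then obtain D where D: "\<And>k. D k \<in> relaxing_diagonals Q" "\<And>k. s - 1 / Suc k < S (D k)"
    by metis
  obtain r where r: "strict_mono r" "\<forall>n<N. convergent (\<lambda>k. D (r k) $$ (n, n))"
    using bounded_sequences_common_convergent_subsequence[of N "\<lambda>k n. D k $$ (n, n)"
        "\<lambda>n. Q $$ (n, n)", OF bound[OF D(1)]] by blast
  define d where "d n = lim (\<lambda>k. D (r k) $$ (n, n))" for n
  have lim: "(\<lambda>k. D (r k) $$ (n, n)) \<longlonglongrightarrow> d n" if "n < N" for n
    using r(2) that unfolding d_def by (simp add: convergent_LIMSEQ_iff)
  have lim_sum: "(\<lambda>k. \<Sum>n\<in>A. D (r k) $$ (n, n) * a n) \<longlonglongrightarrow> (\<Sum>n\<in>A. d n * a n)"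
    if "A \<subseteq> {0..<N}" for A and a :: "nat \<Rightarrow> real"
    using that lim by (intro tendsto_sum tendsto_mult_right) auto
  have mem: "diag_of N d \<in> relaxing_diagonals Q"
    unfolding iff
  proof (intro conjI allI impI ballI)
    fix n assume n: "n < N"
    have "0 \<le> d n" using D(1) n unfolding iff by (intro LIMSEQ_le_const[OF lim[OF n]]) auto
    thus "0 \<le> diag_of N d $$ (n, n)" using n by simp
  next
    fix v :: "real vec" assume v: "v \<in> carrier_vec N"
    have "(\<Sum>n=0..<N. d n * (v $ n)\<^sup>2) \<le> v \<bullet> (Q *\<^sub>v v)"
      using D(1) v unfolding iff by (intro LIMSEQ_le_const2[OF lim_sum]) auto
    thus "(\<Sum>n=0..<N. diag_of N d $$ (n, n) * (v $ n)\<^sup>2) \<le> v \<bullet> (Q *\<^sub>v v)" by simp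
  qed auto
  obtain T where T: "T \<subseteq> {0..<N}" "card T = K"
      "S (diag_of N d) = (\<Sum>n\<in>T. diag_of N d $$ (n, n) * (c $ n)\<^sup>2)"
    using smallest_sum_attained[OF K, of "\<lambda>n. diag_of N d $$ (n, n) * (c $ n)\<^sup>2"]
    unfolding S_def by blast
  have "s \<le> (\<Sum>n\<in>T. d n * (c $ n)\<^sup>2)"
  proof (rule LIMSEQ_le)
    have "(\<lambda>k. s - 1 / Suc k) \<longlonglongrightarrow> s - 0"
      by (intro tendsto_diff tendsto_const) (rule LIMSEQ_Suc[OF lim_1_over_n])
    from LIMSEQ_subseq_LIMSEQ[OF this r(1)] show "(\<lambda>k. s - 1 / Suc (r k)) \<longlonglongrightarrow> s"
      by (simp add: o_def)
    show "(\<lambda>k. \<Sum>n\<in>T. D (r k) $$ (n, n) * (c $ n)\<^sup>2) \<longlonglongrightarrow> (\<Sum>n\<in>T. d n * (c $ n)\<^sup>2)"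
      using T(1) by (rule lim_sum)
    have "s - 1 / Suc (r k) \<le> (\<Sum>n\<in>T. D (r k) $$ (n, n) * (c $ n)\<^sup>2)" for k
    proof -
      have "S (D (r k)) \<le> (\<Sum>n\<in>T. D (r k) $$ (n, n) * (c $ n)\<^sup>2)"
        unfolding S_def using T by (intro smallest_sum_le) auto
      thus ?thesis using D(2)[of "r k"] by linarith
    qed
    thus "\<exists>m. \<forall>k\<ge>m. s - 1 / Suc (r k) \<le> (\<Sum>n\<in>T. D (r k) $$ (n, n) * (c $ n)\<^sup>2)" by blast
  qed
  also have "\<dots> = S (diag_of N d)"
    unfolding T(3) using T(1) by (intro sum.cong) auto
  finally have max: "S (diag_of N d) = s" using S_le_s[OF mem] by linarith
  have "E_d Q c K = s"
    unfolding E_d_def c S_def[symmetric]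
    using mem max S_le_s by (intro Greatest_equality) auto
  with mem max have "E_d Q c K = S (diag_of N d)" by simp
  with mem show "\<exists>D\<in>relaxing_diagonals Q.
      E_d Q c K = smallest_sum K (map (\<lambda>n. D $$ (n, n) * (c $ n)\<^sup>2) [0..<N])"
    unfolding S_def by (rule bexI[rotated])
  show "smallest_sum K (map (\<lambda>n. D $$ (n, n) * (c $ n)\<^sup>2) [0..<N]) \<le> E_d Q c K"
    if "D \<in> relaxing_diagonals Q" for D
    using S_le_s[OF that] \<open>E_d Q c K = s\<close> unfolding S_def by simp
qed

section \<open>Bounds on the numbers of zero components\<close>

lemma lambda_min_pos:
  assumes Q: "Q \<in> carrier_mat N N" and pd: "pos_def_mat Q" and N: "0 < N"
  shows "0 < lambda_min Q"
proof -
  obtain v where v: "v \<in> carrier_vec N" "v \<noteq> 0\<^sub>v N" "Q *\<^sub>v v = lambda_min Q \<cdot>\<^sub>v v"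
    using eigenvalue_lambda_min[OF Q pos_def_matD(1)[OF pd Q] N] Q
    by (auto simp: eigenvalue_def eigenvector_def)
  have "0 < lambda_min Q * (v \<bullet> v)"
    using pos_def_matD(2)[OF pd Q v(1,2)] v by simp
  thus ?thesis using scalar_prod_self_pos[OF v(1,2)] by (simp add: zero_less_mult_iff)
qed

text \<open>Extending a unit vector can only increase its norm, while the form of the Schur complement at the
unit vector is the form of \<open>Q\<close> at the extension.\<close>

lemma lambda_min_le_lambda_max_schur:
  assumes Q: "Q \<in> carrier_mat N N" and pd: "pos_def_mat Q" and Y: "Y \<subset> {0..<N}"
  shows "lambda_min Q \<le> lambda_max (schur_complement Q Y)"
proof -
  have Y': "Y \<subseteq> {0..<N}" using Y by auto
  define k where "k = card ({0..<N} - Y)"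
  have k: "0 < k" unfolding k_def using Y by (auto simp: card_gt_0_iff)
  have N: "0 < N" using Y by (cases N) auto
  define z :: "real vec" where "z = unit_vec k 0"
  have zz: "z \<bullet> z = 1" and z: "z \<in> carrier_vec k" unfolding z_def using k by auto
  obtain x where x: "x \<in> carrier_vec N" "subvec x ({0..<N} - Y) = z"
    "subvec (Q *\<^sub>v x) ({0..<N} - Y) = schur_complement Q Y *\<^sub>v z"
    "subvec (Q *\<^sub>v x) Y = 0\<^sub>v (card Y)"
    using schur_complement_extension[OF Q pd Y' z[unfolded k_def]] .
  have "lambda_min Q = lambda_min Q * (z \<bullet> z)" using zz by simp
  also have "\<dots> \<le> lambda_min Q * (x \<bullet> x)"
    using lambda_min_pos[OF Q pd N] scalar_prod_self_nonneg[of "subvec x Y"]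
      scalar_prod_subvec[OF x(1) x(1) Y'] x(2)
    by (intro mult_left_mono) auto
  also have "\<dots> \<le> x \<bullet> (Q *\<^sub>v x)"
    by (rule lambda_min_le_form[OF Q pos_def_matD(1)[OF pd Q] N x(1)])
  also have "\<dots> = z \<bullet> (schur_complement Q Y *\<^sub>v z)"
    using schur_complement_form[OF Q Y' x(1) x(1) x(3,4)] x(2) by simp
  also have "\<dots> \<le> lambda_max (schur_complement Q Y) * (z \<bullet> z)"
    using form_le_lambda_max[OF schur_complement_carrier[OF Q Y'] schur_complement_symmetric[OF Q pd Y']]
      k z unfolding k_def by blast
  finally show ?thesis using zz by simp
qed

text \<open>The extension \<open>x\<close> of an eigenvector \<open>z\<close> with eigenvalue \<open>l\<close> satisfies
\<open>Q x = l x\<^sub>n e\<^sub>n\<close>. Applying the inverse of \<open>Q\<close> and comparing the components at \<open>n\<close> gives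
\<open>1 = l (Q\<^sup>-\<^sup>1)\<^sub>n\<^sub>n\<close>.\<close>

lemma lambda_max_schur_singleton:
  assumes Q: "Q \<in> carrier_mat N N" and pd: "pos_def_mat Q" and Y: "Y \<subseteq> {0..<N}"
    and n: "{0..<N} - Y = {n}"
  shows "lambda_max (schur_complement Q Y) = 1 / mat_inv Q $$ (n, n)"
proof -
  define S l where "S = schur_complement Q Y" and "l = lambda_max S"
  have nN: "n < N" using n by auto
  have S: "S \<in> carrier_mat 1 1" "transpose_mat S = S"
    using schur_complement_carrier[OF Q Y] schur_complement_symmetric[OF Q pd Y] n
    by (auto simp: S_def)
  obtain z where z: "z \<in> carrier_vec 1" "z \<noteq> 0\<^sub>v 1" "S *\<^sub>v z = l \<cdot>\<^sub>v z"
    using eigenvalue_lambda_max[OF S] S(1) unfolding l_def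
    by (auto simp: eigenvalue_def eigenvector_def)
  have z0: "z $ 0 \<noteq> 0"
  proof
    assume "z $ 0 = 0"
    hence "z = 0\<^sub>v 1" using z(1) by (intro eq_vecI) auto
    thus False using z(2) by simp
  qed
  have z': "z \<in> carrier_vec (card ({0..<N} - Y))" using z(1) n by simp
  obtain x where x: "x \<in> carrier_vec N" "subvec x {n} = z" "subvec (Q *\<^sub>v x) {n} = S *\<^sub>v z"
      "subvec (Q *\<^sub>v x) Y = 0\<^sub>v (card Y)"
    using schur_complement_extension[OF Q pd Y z'] unfolding n S_def by metis
  have pick: "pick {n} 0 = n" using pick_in_set[of 0 "{n}"] by auto
  have xn: "x $ n = z $ 0" unfolding x(2)[symmetric] by (simp add: subvec_def pick del: pick.simps)
  have inv: "mat_inv Q \<in> carrier_mat N N" "mat_inv Q * Q = 1\<^sub>m N"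
    using pos_def_mat_inv[OF pd Q] by auto
  have "x = mat_inv Q *\<^sub>v (Q *\<^sub>v x)"
    using inv Q x(1) by (simp add: assoc_mult_mat_vec[symmetric, of _ N N])
  hence "x $ n = row (mat_inv Q) n \<bullet> (Q *\<^sub>v x)"
    using inv(1) nN by (metis carrier_matD(1) index_mult_mat_vec)
  also have "\<dots> = subvec (row (mat_inv Q) n) {n} \<bullet> (S *\<^sub>v z)"
    using scalar_prod_subvec[of "row (mat_inv Q) n" N "Q *\<^sub>v x", OF _ _ Y] Q inv(1) x(1,3,4) nN
    by (simp add: n)
  also have "\<dots> = mat_inv Q $$ (n, n) * (l * z $ 0)"
    using z inv(1) nN by (simp add: scalar_prod_def subvec_def pick del: pick.simps)
  finally have "mat_inv Q $$ (n, n) * l = 1" using z0 xn by simp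
  moreover from this have "mat_inv Q $$ (n, n) \<noteq> 0" by auto
  ultimately show ?thesis unfolding l_def S_def by (simp add: field_simps)
qed

lemma smallest_sum_sq_entries:
  assumes c: "c \<in> carrier_vec N" and "K \<le> N" and Y: "largest_magnitude_indices c (N - K) Y"
  shows "Y \<subseteq> {0..<N}" "card ({0..<N} - Y) = K"
    "smallest_sum K (sq_entries c) = (\<Sum>n\<in>{0..<N} - Y. (c $ n)\<^sup>2)"
proof -
  show sub: "Y \<subseteq> {0..<N}" using Y c by (auto simp: largest_magnitude_indices_def)
  hence fin: "finite Y" using finite_subset by blast
  show card: "card ({0..<N} - Y) = K"
    using Y sub fin assms(2) by (simp add: card_Diff_subset largest_magnitude_indices_def)
  have dim: "dim_vec c = N" using c by auto
  show "smallest_sum K (sq_entries c) = (\<Sum>n\<in>{0..<N} - Y. (c $ n)\<^sup>2)"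
    unfolding sq_entries_def dim
    using Y c card by (intro smallest_sum_eq) (auto simp: largest_magnitude_indices_def abs_le_square_iff)
qed

text \<open>The cheapest point with zeros on the complement \<open>Z\<close> of \<open>Y\<close> is \<open>c - w\<close>, where \<open>w\<close> is the extension of the restriction of \<open>c\<close>
to \<open>Z\<close>. Its cost is the form of the Schur complement at this restriction, which is at most the
largest eigenvalue times the squared norm.\<close>

lemma feasible_vanishing_point:
  assumes Q: "Q \<in> carrier_mat N N" and pd: "pos_def_mat Q" and c: "c \<in> carrier_vec N"
    and Y: "Y \<subseteq> {0..<N}" and \<gamma>: "0 \<le> \<gamma>"
    and le: "lambda_max (schur_complement Q Y) * (\<Sum>n\<in>{0..<N} - Y. (c $ n)\<^sup>2) \<le> \<gamma>"
  shows "\<exists>x\<in>feasible_set Q c \<gamma>. \<forall>n\<in>{0..<N} - Y. x $ n = 0"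
proof -
  define Z where "Z = {0..<N} - Y"
  define z where "z = subvec c Z"
  have z: "z \<in> carrier_vec (card ({0..<N} - Y))" unfolding z_def Z_def by simp
  obtain w where w: "w \<in> carrier_vec N" "subvec w Z = z"
    "subvec (Q *\<^sub>v w) Z = schur_complement Q Y *\<^sub>v z"
    "subvec (Q *\<^sub>v w) Y = 0\<^sub>v (card Y)"
    using schur_complement_extension[OF Q pd Y z] unfolding Z_def .
  have "w \<bullet> (Q *\<^sub>v w) = z \<bullet> (schur_complement Q Y *\<^sub>v z)"
    using schur_complement_form[OF Q Y w(1) w(1)] w unfolding Z_def by simp
  also have "\<dots> \<le> \<gamma>"
  proof (cases "card Z = 0")
    case True
    thus ?thesis using z \<gamma> unfolding Z_def by (simp add: scalar_prod_def schur_complement_carrier[OF Q Y, THEN carrier_matD(1)])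
  next
    case False
    have "z \<bullet> (schur_complement Q Y *\<^sub>v z) \<le> lambda_max (schur_complement Q Y) * (z \<bullet> z)"
      using form_le_lambda_max[OF schur_complement_carrier[OF Q Y] schur_complement_symmetric[OF Q pd Y]]
        False z unfolding Z_def by simp
    also have "z \<bullet> z = (\<Sum>n\<in>Z. (c $ n)\<^sup>2)"
      using sum_pick[of Z "\<lambda>n. (c $ n)\<^sup>2"]
      by (simp add: z_def Z_def scalar_prod_def subvec_def power2_eq_square)
    finally show ?thesis using le unfolding Z_def by linarith
  qed
  finally have form: "w \<bullet> (Q *\<^sub>v w) \<le> \<gamma>" .
  have minus: "c - w - c = - w" using c w(1) by (intro eq_vecI) auto
  have "Q *\<^sub>v (- w) = - (Q *\<^sub>v w)" using Q w(1) by (intro eq_vecI) (auto intro!: scalar_prod_uminus_right)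
  hence "(- w) \<bullet> (Q *\<^sub>v (- w)) = w \<bullet> (Q *\<^sub>v w)" using Q w(1) by simp
  hence "c - w \<in> feasible_set Q c \<gamma>"
    using form c w(1) by (simp add: feasible_set_def minus)
  moreover have "(c - w) $ n = 0" if n: "n \<in> Z" for n
  proof -
    have "finite Z" by (simp add: Z_def)
    then obtain i where i: "i < card Z" "n = pick Z i"
      using n bij_betw_imp_surj_on[OF bij_betw_pick, of Z] by force
    have "w $ n = c $ n" using arg_cong[OF w(2), of "\<lambda>v. v $ i"] i by (simp add: z_def subvec_def)
    thus ?thesis using n c w(1) by (simp add: Z_def)
  qed
  ultimately show ?thesis unfolding Z_def by blast
qed

lemma num_nonzero_zeros:
  assumes "x \<in> carrier_vec N"
  shows "num_nonzero x + card {n. n < N \<and> x $ n = 0} = N"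
proof -
  have "card {n. n < N \<and> x $ n \<noteq> 0} + card {n. n < N \<and> x $ n = 0} =
      card ({n. n < N \<and> x $ n \<noteq> 0} \<union> {n. n < N \<and> x $ n = 0})"
    by (subst card_Un_disjoint) auto
  also have "{n. n < N \<and> x $ n \<noteq> 0} \<union> {n. n < N \<and> x $ n = 0} = {0..<N}" by auto
  finally show ?thesis using assms by (simp add: num_nonzero_def)
qed

lemma finite_num_nonzero_feasible:
  assumes "c \<in> carrier_vec N"
  shows "finite (num_nonzero ` feasible_set Q c \<gamma>)"
proof (rule finite_subset)
  show "num_nonzero ` feasible_set Q c \<gamma> \<subseteq> {0..N}"
  proof
    fix m assume "m \<in> num_nonzero ` feasible_set Q c \<gamma>"
    then obtain x where "x \<in> carrier_vec N" "m = num_nonzero x"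
      using assms by (auto simp: feasible_set_def)
    thus "m \<in> {0..N}" using num_nonzero_zeros[of x N] by simp
  qed
qed simp

lemma le_K_star:
  assumes c: "c \<in> carrier_vec N" and x: "x \<in> feasible_set Q c \<gamma>"
    and Z: "Z \<subseteq> {0..<N}" "\<forall>n\<in>Z. x $ n = 0"
  shows "card Z \<le> K_star Q c \<gamma>"
proof -
  have xN: "x \<in> carrier_vec N" using x c by (auto simp: feasible_set_def)
  have "Min (num_nonzero ` feasible_set Q c \<gamma>) \<le> num_nonzero x"
    using finite_num_nonzero_feasible[OF c] x by (intro Min_le) auto
  moreover have "card Z \<le> card {n. n < N \<and> x $ n = 0}"
    using Z by (intro card_mono) auto
  ultimately show ?thesis using num_nonzero_zeros[OF xN] c unfolding K_star_def by auto
qed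

lemma K_star_attained:
  assumes Q: "Q \<in> carrier_mat N N" and c: "c \<in> carrier_vec N" and \<gamma>: "0 \<le> \<gamma>"
  obtains x Z where "x \<in> feasible_set Q c \<gamma>" "Z \<subseteq> {0..<N}" "card Z = K_star Q c \<gamma>"
    "\<And>n. n \<in> Z \<Longrightarrow> x $ n = 0"
proof -
  have "c - c = 0\<^sub>v N" using c by auto
  hence "c \<in> feasible_set Q c \<gamma>" using c Q \<gamma> by (auto simp: feasible_set_def)
  hence "Min (num_nonzero ` feasible_set Q c \<gamma>) \<in> num_nonzero ` feasible_set Q c \<gamma>"
    using finite_num_nonzero_feasible[OF c] by (intro Min_in) auto
  then obtain x where x: "x \<in> feasible_set Q c \<gamma>"
      "num_nonzero x = Min (num_nonzero ` feasible_set Q c \<gamma>)" by auto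
  have "x \<in> carrier_vec N" using x(1) c by (auto simp: feasible_set_def)
  hence "card {n. n < N \<and> x $ n = 0} = K_star Q c \<gamma>"
    using num_nonzero_zeros[of x N] x(2) c unfolding K_star_def by auto
  thus thesis by (intro that[OF x(1), of "{n. n < N \<and> x $ n = 0}"]) auto
qed

text \<open>The diagonal problem is a relaxation: at an optimal point of the original problem, the zero
components alone cost \<open>\<Sum> D\<^sub>n\<^sub>n c\<^sub>n\<^sup>2\<close> in the diagonal form, which is dominated by the form of \<open>Q\<close>.\<close>

lemma E_d_K_star_le:
  assumes Q: "Q \<in> carrier_mat N N" and pd: "pos_def_mat Q" and c: "c \<in> carrier_vec N"
    and \<gamma>: "0 \<le> \<gamma>"
  shows "K_star Q c \<gamma> \<le> N" "E_d Q c (K_star Q c \<gamma>) \<le> \<gamma>"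
proof -
  have dim: "dim_vec c = N" using c by auto
  show le: "K_star Q c \<gamma> \<le> N" unfolding K_star_def dim by simp
  note pdD = pos_def_matD[OF pd Q]
  obtain D where D: "D \<in> relaxing_diagonals Q" and E: "E_d Q c (K_star Q c \<gamma>) =
      smallest_sum (K_star Q c \<gamma>) (map (\<lambda>n. D $$ (n, n) * (c $ n)\<^sup>2) [0..<N])"
    using E_d_attained(1)[OF Q pdD(1,3) dim le] by blast
  obtain x Z where x: "x \<in> feasible_set Q c \<gamma>" and Z: "Z \<subseteq> {0..<N}" "card Z = K_star Q c \<gamma>"
      "\<And>n. n \<in> Z \<Longrightarrow> x $ n = 0"
    using K_star_attained[OF Q c \<gamma>] by blast
  have xN: "x \<in> carrier_vec N" and form: "(x - c) \<bullet> (Q *\<^sub>v (x - c)) \<le> \<gamma>"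
    using x c by (auto simp: feasible_set_def)
  have D': "\<forall>n<N. 0 \<le> D $$ (n, n)" "\<forall>v\<in>carrier_vec N. (\<Sum>n=0..<N. D $$ (n, n) * (v $ n)\<^sup>2) \<le> v \<bullet> (Q *\<^sub>v v)"
    using D relaxing_diagonals_iff[OF Q pdD(1)] by auto
  have "E_d Q c (K_star Q c \<gamma>) \<le> (\<Sum>n\<in>Z. D $$ (n, n) * (c $ n)\<^sup>2)"
    unfolding E using Z by (intro smallest_sum_le) auto
  also have "\<dots> = (\<Sum>n\<in>Z. D $$ (n, n) * ((x - c) $ n)\<^sup>2)"
    using Z xN c by (intro sum.cong) auto
  also have "\<dots> \<le> (\<Sum>n=0..<N. D $$ (n, n) * ((x - c) $ n)\<^sup>2)"
    using Z(1) D'(1) by (intro sum_mono2) auto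
  also have "\<dots> \<le> (x - c) \<bullet> (Q *\<^sub>v (x - c))" using D'(2) xN c minus_carrier_vec by blast
  finally show "E_d Q c (K_star Q c \<gamma>) \<le> \<gamma>" using form by linarith
qed

text \<open>The matrix \<open>\<lambda>\<^sub>m\<^sub>i\<^sub>n I\<close> is one of the admissible diagonals.\<close>

lemma lambda_min_smallest_sum_le_E_d:
  assumes Q: "Q \<in> carrier_mat N N" and pd: "pos_def_mat Q" and c: "c \<in> carrier_vec N"
    and N: "0 < N" and K: "K \<le> N"
  shows "lambda_min Q * smallest_sum K (sq_entries c) \<le> E_d Q c K"
proof -
  define l where "l = lambda_min Q"
  have dim: "dim_vec c = N" using c by auto
  note pdD = pos_def_matD[OF pd Q]
  have l: "0 < l" unfolding l_def using lambda_min_pos[OF Q pd N] .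
  have "(\<Sum>n=0..<N. l * (v $ n)\<^sup>2) \<le> v \<bullet> (Q *\<^sub>v v)" if "v \<in> carrier_vec N" for v
    using lambda_min_le_form[OF Q pdD(1) N that] that
    by (simp add: l_def scalar_prod_def sum_distrib_left power2_eq_square)
  hence mem: "diag_of N (\<lambda>_. l) \<in> relaxing_diagonals Q"
    unfolding relaxing_diagonals_iff[OF Q pdD(1)] using l by auto
  obtain T where T: "T \<subseteq> {0..<N}" "card T = K"
      "smallest_sum K (map (\<lambda>n. diag_of N (\<lambda>_. l) $$ (n, n) * (c $ n)\<^sup>2) [0..<N]) =
        (\<Sum>n\<in>T. diag_of N (\<lambda>_. l) $$ (n, n) * (c $ n)\<^sup>2)"
    using smallest_sum_attained[OF K, of "\<lambda>n. diag_of N (\<lambda>_. l) $$ (n, n) * (c $ n)\<^sup>2"] by blast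
  have "smallest_sum K (sq_entries c) \<le> (\<Sum>n\<in>T. (c $ n)\<^sup>2)"
    unfolding sq_entries_def dim using T by (intro smallest_sum_le) auto
  hence "l * smallest_sum K (sq_entries c) \<le> l * (\<Sum>n\<in>T. (c $ n)\<^sup>2)"
    using l by (intro mult_left_mono) auto
  also have "\<dots> = (\<Sum>n\<in>T. diag_of N (\<lambda>_. l) $$ (n, n) * (c $ n)\<^sup>2)"
    using T(1) unfolding sum_distrib_left by (intro sum.cong) auto
  also have "\<dots> \<le> E_d Q c K"
    using E_d_attained(2)[OF Q pdD(1,3) dim K mem] unfolding T(3) .
  finally show ?thesis unfolding l_def .
qed

lemma smallest_sum_0 [simp]: "smallest_sum 0 as = 0"
  by (simp add: smallest_sum_def)

text \<open>The assumption on the single components implies that \<open>K = 1\<close> is admissible in the definition of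
\<^const>\<open>K_lower\<close>. Positivity of \<^const>\<open>K_lower\<close> makes the quotients in the ratio bounds genuine
ones, since division by zero yields zero.\<close>

lemma K_lower_bounds:
  assumes Q: "Q \<in> carrier_mat N N" and pd: "pos_def_mat Q" and c: "c \<in> carrier_vec N"
    and N: "1 \<le> N" and \<gamma>: "0 < \<gamma>"
    and single: "\<forall>n<N. (c $ n)\<^sup>2 / mat_inv Q $$ (n, n) \<le> \<gamma>"
    and Y: "\<forall>K\<le>N. largest_magnitude_indices c (N - K) (Y K)"
  shows "1 \<le> K_lower Q c \<gamma> Y" "K_lower Q c \<gamma> Y \<le> K_star Q c \<gamma>"
    "K_lower Q c \<gamma> Y + 1 \<le> N \<Longrightarrow> \<gamma> < lambda_max (schur_complement Q (Y (K_lower Q c \<gamma> Y + 1)))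
      * smallest_sum (K_lower Q c \<gamma> Y + 1) (sq_entries c)"
proof -
  define A where "A = {K. K \<le> N \<and> 
     lambda_max (schur_complement Q (Y K)) * smallest_sum K (sq_entries c) \<le> \<gamma>}"
  have dim: "dim_vec c = N" using c by auto
  have KA: "K_lower Q c \<gamma> Y = Max A" unfolding K_lower_def A_def dim ..
  have fin: "finite A" unfolding A_def by simp
  note Y1 = smallest_sum_sq_entries[OF c N Y[rule_format, OF N]]
  obtain n where n: "{0..<N} - Y 1 = {n}" using Y1(2) by (auto simp: card_1_singleton_iff)
  hence "n < N" by auto
  hence "1 \<in> A"
    using single N lambda_max_schur_singleton[OF Q pd Y1(1) n] Y1(3)
    by (simp add: A_def n del: One_nat_def)
  thus "1 \<le> K_lower Q c \<gamma> Y" unfolding KA using fin by simp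
  have "K_lower Q c \<gamma> Y \<in> A" unfolding KA using fin \<open>1 \<in> A\<close> by (intro Max_in) auto
  hence K: "K_lower Q c \<gamma> Y \<le> N" "lambda_max (schur_complement Q (Y (K_lower Q c \<gamma> Y)))
      * smallest_sum (K_lower Q c \<gamma> Y) (sq_entries c) \<le> \<gamma>"
    by (auto simp: A_def)
  note YK = smallest_sum_sq_entries[OF c K(1) Y[rule_format, OF K(1)]]
  obtain x where "x \<in> feasible_set Q c \<gamma>" "\<forall>n\<in>{0..<N} - Y (K_lower Q c \<gamma> Y). x $ n = 0"
    using feasible_vanishing_point[OF Q pd c YK(1), of \<gamma>] K(2) YK(3) \<gamma> by auto
  thus "K_lower Q c \<gamma> Y \<le> K_star Q c \<gamma>"
    using le_K_star[OF c, of x Q \<gamma> "{0..<N} - Y (K_lower Q c \<gamma> Y)"] YK(2) by auto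
  assume "K_lower Q c \<gamma> Y + 1 \<le> N"
  moreover have "K_lower Q c \<gamma> Y + 1 \<notin> A"
    unfolding KA using Max_ge[OF fin, of "Max A + 1"] by auto
  ultimately show "\<gamma> < lambda_max (schur_complement Q (Y (K_lower Q c \<gamma> Y + 1)))
      * smallest_sum (K_lower Q c \<gamma> Y + 1) (sq_entries c)"
    unfolding A_def by auto
qed

lemma K_upper_maximal:
  assumes "c \<in> carrier_vec N" "0 \<le> \<gamma>"
  shows "K_upper Q c \<gamma> \<le> N" "lambda_min Q * smallest_sum (K_upper Q c \<gamma>) (sq_entries c) \<le> \<gamma>"
    "\<And>K. K \<le> N \<Longrightarrow> lambda_min Q * smallest_sum K (sq_entries c) \<le> \<gamma> \<Longrightarrow> K \<le> K_upper Q c \<gamma>"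
proof -
  define A where "A = {K. K \<le> N \<and> lambda_min Q * smallest_sum K (sq_entries c) \<le> \<gamma>}"
  have dim: "dim_vec c = N" using assms by auto
  have KA: "K_upper Q c \<gamma> = Max A" unfolding K_upper_def A_def dim ..
  have fin: "finite A" unfolding A_def by simp
  have "0 \<in> A" using assms by (simp add: A_def)
  hence "K_upper Q c \<gamma> \<in> A" unfolding KA using fin by (intro Max_in) auto
  thus "K_upper Q c \<gamma> \<le> N" "lambda_min Q * smallest_sum (K_upper Q c \<gamma>) (sq_entries c) \<le> \<gamma>"
    by (auto simp: A_def)
  show "K \<le> K_upper Q c \<gamma>" if "K \<le> N" "lambda_min Q * smallest_sum K (sq_entries c) \<le> \<gamma>" for K
    unfolding KA using fin that by (intro Max_ge) (auto simp: A_def)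
qed

lemma K_d_bounds:
  assumes Q: "Q \<in> carrier_mat N N" and pd: "pos_def_mat Q" and c: "c \<in> carrier_vec N"
    and N: "0 < N" and \<gamma>: "0 \<le> \<gamma>"
  shows "K_star Q c \<gamma> \<le> K_d Q c \<gamma>" "K_d Q c \<gamma> \<le> K_upper Q c \<gamma>"
proof -
  define A where "A = {K. K \<le> N \<and> E_d Q c K \<le> \<gamma>}"
  have dim: "dim_vec c = N" using c by auto
  have KA: "K_d Q c \<gamma> = Max A" unfolding K_d_def A_def dim ..
  have fin: "finite A" unfolding A_def by simp
  have mem: "K_star Q c \<gamma> \<in> A" unfolding A_def using E_d_K_star_le[OF Q pd c \<gamma>] by simp
  thus "K_star Q c \<gamma> \<le> K_d Q c \<gamma>" unfolding KA using fin by simp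
  have "K_d Q c \<gamma> \<in> A" unfolding KA using fin mem by (intro Max_in) auto
  hence "K_d Q c \<gamma> \<le> N" "E_d Q c (K_d Q c \<gamma>) \<le> \<gamma>" by (auto simp: A_def)
  thus "K_d Q c \<gamma> \<le> K_upper Q c \<gamma>"
    using lambda_min_smallest_sum_le_E_d[OF Q pd c N] \<gamma> 
    by (intro K_upper_maximal(3)[OF c \<gamma>]) (auto intro: order_trans)
qed

text \<open>For \<open>K \<le> U\<close>, with \<open>U\<close> the upper bound \<^const>\<open>K_upper\<close>, the average of the \<open>K\<close> smallest squares is at
most that of the \<open>U\<close> smallest ones, so \<open>\<lambda>\<^sub>m\<^sub>i\<^sub>n U S\<^sub>K \<le> K \<lambda>\<^sub>m\<^sub>i\<^sub>n S\<^sub>U \<le> K \<gamma> < K \<lambda>\<^sub>m\<^sub>a\<^sub>x S\<^sub>K\<close> and \<open>S\<^sub>K\<close>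
cancels. For \<open>U < K\<close> it suffices that \<open>\<lambda>\<^sub>m\<^sub>i\<^sub>n\<close> of \<open>Q\<close> is at most \<open>\<lambda>\<^sub>m\<^sub>a\<^sub>x\<close> of the Schur complement.\<close>

lemma K_upper_less:
  assumes Q: "Q \<in> carrier_mat N N" and pd: "pos_def_mat Q" and c: "c \<in> carrier_vec N"
    and \<gamma>: "0 \<le> \<gamma>" and K: "1 \<le> K" "K \<le> N" and Y: "largest_magnitude_indices c (N - K) Y"
    and gt: "\<gamma> < lambda_max (schur_complement Q Y) * smallest_sum K (sq_entries c)"
  shows "real (K_upper Q c \<gamma>) < real K * lambda_max (schur_complement Q Y) / lambda_min Q"
proof -
  define U l L s where "U = K_upper Q c \<gamma>" and "l = lambda_min Q"
    and "L = lambda_max (schur_complement Q Y)" and "s m = smallest_sum m (sq_entries c)" for m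
  note YK = smallest_sum_sq_entries[OF c K(2) Y]
  have l: "0 < l" unfolding l_def using lambda_min_pos[OF Q pd] K by simp
  have "Y \<noteq> {0..<N}" using YK(2) K(1) by auto
  hence lL: "l \<le> L"
    unfolding l_def L_def using lambda_min_le_lambda_max_schur[OF Q pd, of Y] YK(1) by blast
  have U: "U \<le> N" "l * s U \<le> \<gamma>" using K_upper_maximal[OF c \<gamma>] by (auto simp: U_def l_def s_def)
  have "real U * l < real K * L"
  proof (cases "K \<le> U")
    case True
    have "real U * s K \<le> real K * s U"
      unfolding s_def using smallest_sum_superlinear[OF K(1) True] U(1) c by (simp add: sq_entries_def)
    hence "l * (real U * s K) \<le> real K * (l * s U)"
      using l by (metis mult.left_commute mult_left_mono less_imp_le)
    also have "\<dots> \<le> real K * \<gamma>" using U(2) by (intro mult_left_mono) auto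
    also have "\<dots> < real K * (L * s K)" using gt K(1) by (simp add: L_def s_def)
    finally have "(real U * l) * s K < (real K * L) * s K" by (simp add: mult_ac)
    moreover have "0 \<le> s K" unfolding s_def YK(3) by (intro sum_nonneg) auto
    ultimately show ?thesis by (simp add: mult_less_cancel_right)
  next
    case False
    hence "real U * l < real K * l" using l by simp
    also have "\<dots> \<le> real K * L" using lL by (intro mult_left_mono) auto
    finally show ?thesis .
  qed
  thus ?thesis using l unfolding U_def l_def L_def by (simp add: field_simps)
qed

theorem theorem4p2:
  fixes N :: nat and Q :: "real mat" and c :: "real vec" and \<gamma> :: real
    and Y :: "nat \<Rightarrow> nat set"
  assumes "1 \<le> N"
    and "Q \<in> carrier_mat N N" and "pos_def_mat Q"
    and "c \<in> carrier_vec N"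
    and "0 < \<gamma>"
    and "\<forall>n<N. (c $ n)\<^sup>2 / mat_inv Q $$ (n, n) \<le> \<gamma>"
    and "\<forall>K\<le>N. largest_magnitude_indices c (N - K) (Y K)"
  shows "K_lower Q c \<gamma> Y \<le> K_star Q c \<gamma> \<and>
         K_star Q c \<gamma> \<le> K_d Q c \<gamma> \<and>
         K_d Q c \<gamma> \<le> K_upper Q c \<gamma> \<and>
         real (K_d Q c \<gamma>) / real (K_star Q c \<gamma>)
           \<le> real (K_upper Q c \<gamma>) / real (K_lower Q c \<gamma> Y) \<and>
         (K_lower Q c \<gamma> Y + 1 \<le> N \<longrightarrow>
           real (K_upper Q c \<gamma>) / real (K_lower Q c \<gamma> Y)
             \<le> (of_int \<lceil>real (K_lower Q c \<gamma> Y + 1)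
                   * lambda_max (schur_complement Q (Y (K_lower Q c \<gamma> Y + 1)))
                   / lambda_min Q\<rceil> - 1) / real (K_lower Q c \<gamma> Y))"
proof -
  note lower = K_lower_bounds[OF assms(2-4,1,5-7)]
  have \<gamma>: "0 \<le> \<gamma>" and N: "0 < N" using assms(1,5) by auto
  note mid = K_d_bounds[OF assms(2-4) N \<gamma>]
  have ratio: "real (K_d Q c \<gamma>) / real (K_star Q c \<gamma>) \<le> real (K_upper Q c \<gamma>) / real (K_lower Q c \<gamma> Y)"
    using lower(1,2) mid by (intro frac_le) auto
  have "real (K_upper Q c \<gamma>) / real (K_lower Q c \<gamma> Y)
      \<le> (of_int \<lceil>real K * lambda_max (schur_complement Q (Y K)) / lambda_min Q\<rceil> - 1)
        / real (K_lower Q c \<gamma> Y)"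
    if K: "K = K_lower Q c \<gamma> Y + 1" "K \<le> N" for K
  proof (rule divide_right_mono)
    let ?t = "real K * lambda_max (schur_complement Q (Y K)) / lambda_min Q"
    have "real (K_upper Q c \<gamma>) < ?t"
      using lower(3) K assms(7)
      by (intro K_upper_less[OF assms(2-4) \<gamma>]) auto
    \<comment> \<open>An integer below a real number is at most the ceiling of this number minus one.\<close>
    hence "of_int (int (K_upper Q c \<gamma>)) < ?t" by simp
    hence "int (K_upper Q c \<gamma>) < \<lceil>?t\<rceil>" by (simp only: less_ceiling_iff)
    thus "real (K_upper Q c \<gamma>) \<le> of_int \<lceil>?t\<rceil> - 1" by linarith
  qed simp
  thus ?thesis using lower(2) mid ratio by blast
qed

end
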